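(* Let $X$ be an infinite discrete space and $G=(\mathrm S(X),\tau_p)$ its permutation group with the topology of pointwise convergence. Then: (a) the Alexandroff one-point compactification $\alpha X=X\cup\{\infty\}$ is the unique $G$-compactification of $X$; (b) $e_{\alpha X}G=b_rG$ (as compactifications of $G$), and $G$ is Roelcke precompact; (c) $b_rG$ is the set of self-maps $f$ of $\alpha X$, with the topology of pointwise convergence, for which there is a subset $Y\subset X$ such that $f|_Y$ is an injection of $Y$ into $X$ and $f(\alpha X\setminus Y)=\{\infty\}$; (d) $b_rG$ is a sim-compactification of $G$, isomorphic to the symmetric inverse semigroup $I_X$, and it is the maximal sm-compactification of $G$ (the WAP-compactification of $G$).
   Context: For a compact $K$ on which $G$ acts, $e_KG$ is the closure of $\{x\mapsto gx: g\in G\}$ in $K^K$ with the product topology (a monoid under composition). The Roelcke uniformity $L\wedge R$ on $G$ has base of covers $\{OgO:g\in G\}$, $O$ a neighbourhood of $e$; $G$ is Roelcke precompact if it is totally bounded, and then the Roelcke compactification $b_rG$ is the completion of $(G,L\wedge R)$. A $G$-compactification of a $G$-space $X$ is the completion with respect to a totally bounded equiuniformity. An sm-compactification (resp. sim-compactification) of $G$ is a compactification $bG$ of $G$ with continuous extended left action of $G$ which is a semitopological monoid (resp. semitopological inverse monoid with continuous inversion) whose multiplication restricted to $G\times bG$ is the extended left action. The symmetric inverse semigroup $I_X$ is the monoid of all partial bijections between subsets of $X$ under composition. *)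

theory Defs
  imports "HOL-Analysis.Analysis"
begin

definition alexandroff :: "'a topology \<Rightarrow> 'a option topology" where
  "alexandroff T = topology (\<lambda>U. U \<subseteq> insert None (Some ` topspace T) \<and>
      (None \<notin> U \<longrightarrow> openin T (Some -` U)) \<and>
      (None \<in> U \<longrightarrow> compactin T (topspace T - Some -` U) \<and>
                     closedin T (topspace T - Some -` U)))"

definition compactification :: "'a topology \<Rightarrow> 'b topology \<Rightarrow> ('a \<Rightarrow> 'b) \<Rightarrow> bool" where
  "compactification Y K e \<longleftrightarrow> compact_space K \<and> Hausdorff_space K \<and> embedding_map Y K e
     \<and> K closure_of (e ` topspace Y) = topspace K"

definition equiv_compactification ::
  "'a topology \<Rightarrow> 'b topology \<Rightarrow> ('a \<Rightarrow> 'b) \<Rightarrow> 'c topology \<Rightarrow> ('a \<Rightarrow> 'c) \<Rightarrow> bool" where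
  "equiv_compactification Y K1 e1 K2 e2 \<longleftrightarrow>
     (\<exists>h. homeomorphic_map K1 K2 h \<and> (\<forall>y\<in>topspace Y. h (e1 y) = e2 y))"

definition G_compactification ::
  "'g topology \<Rightarrow> ('g \<Rightarrow> 'x \<Rightarrow> 'x) \<Rightarrow> 'x topology \<Rightarrow> 'k topology \<Rightarrow> ('x \<Rightarrow> 'k)
     \<Rightarrow> ('g \<Rightarrow> 'k \<Rightarrow> 'k) \<Rightarrow> bool" where
  "G_compactification Gtop act X K e \<alpha> \<longleftrightarrow> compactification X K e
     \<and> continuous_map (prod_topology Gtop K) K (\<lambda>(g,y). \<alpha> g y)
     \<and> (\<forall>g\<in>topspace Gtop. \<forall>x\<in>topspace X. \<alpha> g (e x) = e (act g x))"

definition dbl :: "('g \<Rightarrow> 'g \<Rightarrow> 'g) \<Rightarrow> 'g set \<Rightarrow> 'g \<Rightarrow> 'g set" where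
  "dbl gmul U g = {gmul (gmul a g) b | a b. a \<in> U \<and> b \<in> U}"

text \<open>Roelcke precompactness: the Roelcke uniformity (base of covers {OgO}) is totally bounded.\<close>
definition roelcke_precompact :: "'g topology \<Rightarrow> ('g \<Rightarrow> 'g \<Rightarrow> 'g) \<Rightarrow> 'g \<Rightarrow> bool" where
  "roelcke_precompact Gtop gmul one \<longleftrightarrow>
     (\<forall>U. openin Gtop U \<and> one \<in> U \<longrightarrow>
        (\<exists>F. finite F \<and> F \<subseteq> topspace Gtop \<and> topspace Gtop = \<Union> (dbl gmul U ` F)))"

text \<open>(K,e) is (a copy of) the Roelcke compactification b_r G: a compactification of G
  such that the unique uniformity of K (the neighbourhoods of the diagonal) induces on G
  exactly the Roelcke uniformity L \<and> R, whose entourages are generated by the sets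
  \<Union>g. OgO \<times> OgO, U a neighbourhood of the identity.  I.e. K is the completion
  of (G, L \<and> R).\<close>
definition roelcke_compactification ::
  "'g topology \<Rightarrow> ('g \<Rightarrow> 'g \<Rightarrow> 'g) \<Rightarrow> 'g \<Rightarrow> 'k topology \<Rightarrow> ('g \<Rightarrow> 'k) \<Rightarrow> bool" where
  "roelcke_compactification Gtop gmul one K e \<longleftrightarrow> compactification Gtop K e
     \<and> (\<forall>W. openin (prod_topology K K) W \<and> (\<forall>z\<in>topspace K. (z,z) \<in> W) \<longrightarrow>
          (\<exists>U. openin Gtop U \<and> one \<in> U \<and>
             (\<forall>g\<in>topspace Gtop. \<forall>a\<in>dbl gmul U g. \<forall>b\<in>dbl gmul U g. (e a, e b) \<in> W)))
     \<and> (\<forall>U. openin Gtop U \<and> one \<in> U \<longrightarrow>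
          (\<exists>W. openin (prod_topology K K) W \<and> (\<forall>z\<in>topspace K. (z,z) \<in> W) \<and>
             (\<forall>a\<in>topspace Gtop. \<forall>b\<in>topspace Gtop. (e a, e b) \<in> W \<longrightarrow>
                (\<exists>g\<in>topspace Gtop. a \<in> dbl gmul U g \<and> b \<in> dbl gmul U g))))"

definition env_top :: "'k topology \<Rightarrow> ('g \<Rightarrow> 'k \<Rightarrow> 'k) \<Rightarrow> 'g set \<Rightarrow> ('k \<Rightarrow> 'k) topology" where
  "env_top K \<alpha> G = subtopology (product_topology (\<lambda>_. K) (topspace K))
      ((product_topology (\<lambda>_. K) (topspace K)) closure_of
         ((\<lambda>g. restrict (\<alpha> g) (topspace K)) ` G))"

definition env_map :: "'k topology \<Rightarrow> ('g \<Rightarrow> 'k \<Rightarrow> 'k) \<Rightarrow> 'g \<Rightarrow> ('k \<Rightarrow> 'k)" where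
  "env_map K \<alpha> g = restrict (\<alpha> g) (topspace K)"

definition sm_compactification ::
  "'g topology \<Rightarrow> ('g \<Rightarrow> 'g \<Rightarrow> 'g) \<Rightarrow> 'k topology \<Rightarrow> ('g \<Rightarrow> 'k) \<Rightarrow> ('k \<Rightarrow> 'k \<Rightarrow> 'k) \<Rightarrow> bool" where
  "sm_compactification Gtop gmul K e m \<longleftrightarrow> compactification Gtop K e
     \<and> (\<forall>x\<in>topspace K. \<forall>y\<in>topspace K. m x y \<in> topspace K)
     \<and> (\<forall>x\<in>topspace K. \<forall>y\<in>topspace K. \<forall>z\<in>topspace K. m (m x y) z = m x (m y z))
     \<and> (\<exists>u\<in>topspace K. \<forall>x\<in>topspace K. m u x = x \<and> m x u = x)
     \<and> (\<forall>a\<in>topspace K. continuous_map K K (m a) \<and> continuous_map K K (\<lambda>x. m x a))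
     \<and> continuous_map (prod_topology Gtop K) K (\<lambda>(g,y). m (e g) y)
     \<and> (\<forall>g\<in>topspace Gtop. \<forall>h\<in>topspace Gtop. m (e g) (e h) = e (gmul g h))"

definition is_inverse_of :: "('k \<Rightarrow> 'k \<Rightarrow> 'k) \<Rightarrow> 'k set \<Rightarrow> 'k \<Rightarrow> 'k \<Rightarrow> bool" where
  "is_inverse_of m S s t \<longleftrightarrow> t \<in> S \<and> m (m s t) s = s \<and> m (m t s) t = t"

definition sim_compactification ::
  "'g topology \<Rightarrow> ('g \<Rightarrow> 'g \<Rightarrow> 'g) \<Rightarrow> 'k topology \<Rightarrow> ('g \<Rightarrow> 'k) \<Rightarrow> ('k \<Rightarrow> 'k \<Rightarrow> 'k) \<Rightarrow> bool" where
  "sim_compactification Gtop gmul K e m \<longleftrightarrow> sm_compactification Gtop gmul K e m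
     \<and> (\<forall>s\<in>topspace K. \<exists>!t. is_inverse_of m (topspace K) s t)
     \<and> continuous_map K K (\<lambda>s. THE t. is_inverse_of m (topspace K) s t)"

definition sym_inverse_semigroup :: "'a set \<Rightarrow> ('a \<rightharpoonup> 'a) set" where
  "sym_inverse_semigroup X = {f. dom f \<subseteq> X \<and> ran f \<subseteq> X \<and> inj_on f (dom f)}"

definition monoid_iso_to_IX ::
  "'k set \<Rightarrow> ('k \<Rightarrow> 'k \<Rightarrow> 'k) \<Rightarrow> 'a set \<Rightarrow> ('k \<Rightarrow> ('a \<rightharpoonup> 'a)) \<Rightarrow> bool" where
  "monoid_iso_to_IX S m X \<phi> \<longleftrightarrow> bij_betw \<phi> S (sym_inverse_semigroup X)
     \<and> (\<forall>s\<in>S. \<forall>t\<in>S. \<phi> (m s t) = \<phi> s \<circ>\<^sub>m \<phi> t)"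

definition perm_top :: "('a \<Rightarrow> 'a) topology" where
  "perm_top = subtopology (product_topology (\<lambda>_. discrete_topology UNIV) UNIV) {f. bij f}"

abbreviation alphaX :: "'a option topology" where
  "alphaX \<equiv> alexandroff (discrete_topology (UNIV :: 'a set))"

definition pinj_maps :: "('a option \<Rightarrow> 'a option) set" where
  "pinj_maps = {f. \<exists>Y :: 'a set. inj_on f (Some ` Y) \<and> f ` (Some ` Y) \<subseteq> Some ` UNIV
                     \<and> f ` (UNIV - Some ` Y) = {None}}"

end

theory Submission
  imports Defs
begin

text \<open>
  Writing a self-map of \<open>\<alpha>X\<close> that fixes \<open>\<infinity>\<close> and is injective where finite as a partial injection of
  \<open>X\<close>, the basic neighbourhoods of such a map \<open>z\<close> consist of the maps with the same graph as \<open>z\<close>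
  inside \<open>F \<times> F\<close>, for finite \<open>F \<subseteq> X\<close>. Two permutations have the same graph inside \<open>F \<times> F\<close> exactly
  when they lie in the same double coset of the pointwise stabiliser of \<open>F\<close>; hence the compact space
  of partial injections, in which the permutations are dense, induces the Roelcke uniformity.
  For maximality, a continuous real function on an sm-compactification is left uniformly continuous
  on the group by compactness and right uniformly continuous by a double limit argument, so it is
  Roelcke uniformly continuous.
\<close>

section \<open>Permutations\<close>

text \<open>The hard point is right uniform continuity in an sm-compactification: joint continuity
  is granted only for the group acting from the left, so the compactness argument has no mirror
  image. The double limit argument needs permutations \<open>h j\<close> that turn one member of a
  bad pair into the other in one order of the limits and act trivially in the other order. By left
  uniform continuity, the value of \<open>u\<close> at a permutation depends, up to a small error,
  only on the inverse permutation on one fixed finite set \<open>F\<close>, so a bad pair may be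
  replaced by the restrictions of two inverses to \<open>F\<close>. These can be thinned until each
  point of \<open>F\<close> either has one common constant value or runs through values never met
  before. Both families then have the same pattern of coincidences, so a permutation of finite
  support carries the first \<open>j\<close> members of one to those of the other; because its
  support is finite, it leaves the late members alone.\<close>

definition fixator :: "'a set \<Rightarrow> ('a \<Rightarrow> 'a) set" where
  "fixator F = {g. bij g \<and> (\<forall>x\<in>F. g x = x)}"

lemma fixatorD: "g \<in> fixator F \<Longrightarrow> bij g" "g \<in> fixator F \<Longrightarrow> x \<in> F \<Longrightarrow> g x = x"
  by (auto simp: fixator_def)

lemma id_in_fixator: "id \<in> fixator F"
  by (simp add: fixator_def)

text \<open>Inside the finite set \<open>?S\<close> the complements of domain and range have equal
  size, so any bijection \<open>r\<close> between them closes the map up. The finite support is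
  recorded because the double limit argument depends on it.\<close>

lemma finite_inj_extends_to_permutation:
  assumes "finite A" and "inj_on q A"
  obtains h where "bij h" "finite {x. h x \<noteq> x}" "\<And>x. x \<in> A \<Longrightarrow> h x = q x"
proof -
  let ?S = "A \<union> q ` A"
  have fin: "finite ?S" using assms by simp
  have "card (?S - A) = card (?S - q ` A)"
    using assms by (simp add: card_Diff_subset card_image)
  then obtain r where r: "bij_betw r (?S - A) (?S - q ` A)"
    using finite_same_card_bij[of "?S - A" "?S - q ` A"] fin by auto
  define h where "h x = (if x \<in> A then q x else if x \<in> ?S then r x else x)" for x
  have "h ` (?S - A) = r ` (?S - A)" by (rule image_cong) (auto simp: h_def)
  then have hS: "h ` (?S - A) = ?S - q ` A" using bij_betw_imp_surj_on[OF r] by simp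
  have hA: "h ` A = q ` A" and hN: "h ` (- ?S) = - ?S"
    by (auto simp: h_def image_iff)
  have "inj_on h A" using assms(2) by (simp add: h_def inj_on_def)
  moreover have "inj_on h (?S - A)"
    by (rule inj_on_cong[THEN iffD1, OF _ bij_betw_imp_inj_on[OF r]]) (auto simp: h_def)
  moreover have "inj_on h (- ?S)" by (simp add: h_def inj_on_def)
  ultimately have "inj_on h (A \<union> ((?S - A) \<union> - ?S))"
    using hA hS hN by (simp only: inj_on_Un image_Un) blast
  moreover have "A \<union> ((?S - A) \<union> - ?S) = UNIV" by blast
  moreover have "h ` (A \<union> ((?S - A) \<union> - ?S)) = UNIV"
    by (simp only: image_Un hA hS hN) blast
  ultimately have "bij h" by (simp only: bij_def)
  moreover have "finite {x. h x \<noteq> x}"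
    by (rule finite_subset[OF _ fin]) (auto simp: h_def)
  moreover have "h x = q x" if "x \<in> A" for x
    using that by (simp add: h_def)
  ultimately show thesis by (rule that)
qed

text \<open>Prescriptions may repeat a point under several indices, so an equality pattern replaces
  injectivity: one direction of it makes \<open>b\<close> factor through \<open>a\<close>, the other
  makes the factor \<open>q\<close> injective.\<close>

lemma finite_family_permutation:
  assumes "finite J" and "\<And>s t. s \<in> J \<Longrightarrow> t \<in> J \<Longrightarrow> a s = a t \<longleftrightarrow> b s = b t"
  obtains h where "bij h" "finite {x. h x \<noteq> x}" "\<And>s. s \<in> J \<Longrightarrow> h (a s) = b s"
proof -
  define q where "q = b \<circ> inv_into J a"
  have q: "q (a s) = b s" if "s \<in> J" for s
  proof -
    have "inv_into J a (a s) \<in> J" "a (inv_into J a (a s)) = a s"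
      using that by (simp_all add: inv_into_into f_inv_into_f)
    then show ?thesis using assms(2) that by (simp add: q_def)
  qed
  have "inj_on q (a ` J)"
  proof (rule inj_onI)
    fix u v assume "u \<in> a ` J" "v \<in> a ` J" "q u = q v"
    then obtain s t where "s \<in> J" "t \<in> J" "u = a s" "v = a t" "b s = b t"
      using q by (elim imageE) simp
    then show "u = v" using assms(2) by blast
  qed
  then obtain h where "bij h" "finite {x. h x \<noteq> x}" "\<And>x. x \<in> a ` J \<Longrightarrow> h x = q x"
    using finite_inj_extends_to_permutation[of "a ` J" q] assms(1) by blast
  then show thesis using q by (intro that[of h]) simp_all
qed

text \<open>Only the part of the graph in \<open>F\<close> x \<open>F\<close> is compared: a value
  outside \<open>F\<close> counts the same as \<open>None\<close>. This matches the topology, in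
  which neighbourhoods of \<open>None\<close> exclude finitely many points, and it gives an
  equivalence relation with finitely many classes when \<open>F\<close> is finite.\<close>

definition agree :: "'a set \<Rightarrow> ('a option \<Rightarrow> 'a option) \<Rightarrow> ('a option \<Rightarrow> 'a option) \<Rightarrow> bool" where
  "agree F f g \<longleftrightarrow> (\<forall>x\<in>F. \<forall>y\<in>F. f (Some x) = Some y \<longleftrightarrow> g (Some x) = Some y)"

lemma agree_refl: "agree F f f"
  and agree_sym: "agree F f g \<Longrightarrow> agree F g f"
  and agree_trans: "agree F f g \<Longrightarrow> agree F g h \<Longrightarrow> agree F f h"
  and agree_mono: "agree F f g \<Longrightarrow> E \<subseteq> F \<Longrightarrow> agree E f g"
  by (auto simp: agree_def)

lemma agree_map_option:
  "agree F (map_option g) (map_option h) \<longleftrightarrow> (\<forall>x\<in>F. \<forall>y\<in>F. g x = y \<longleftrightarrow> h x = y)"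
  by (simp add: agree_def)

lemma agree_double_coset:
  assumes "a \<in> fixator F" "b \<in> fixator F"
  shows "agree F (map_option g) (map_option (a \<circ> g \<circ> b))"
proof -
  have "a z = y \<longleftrightarrow> z = y" if "y \<in> F" for y z
    using fixatorD(1)[OF assms(1), THEN bij_is_inj, THEN inj_eq, of z y] fixatorD(2)[OF assms(1) that] by simp
  with assms(2) show ?thesis
    by (auto simp: agree_map_option fixator_def)
qed

text \<open>Solve for \<open>h = inv b\<close>: it must fix \<open>F\<close> pointwise and carry
  \<open>inv g x\<close> to \<open>inv g' x\<close> for \<open>x\<close> in \<open>F\<close>.
  Agreement is just what makes these conditions compatible, and then \<open>a\<close> fixes
  \<open>F\<close> as well.\<close>

lemma double_coset_if_agree:
  assumes "finite F" "bij g" "bij g'" and ag: "agree F (map_option g) (map_option g')"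
  obtains a b where "a \<in> fixator F" "b \<in> fixator F" "g' = a \<circ> g \<circ> b"
proof -
  let ?J = "{True, False} \<times> F"
  \<comment> \<open>The tag \<open>True\<close> stands for the condition that \<open>x\<close> is
    fixed, \<open>False\<close> for the condition on the preimages of \<open>x\<close>.\<close>
  let ?a = "\<lambda>(s, x). if s then x else inv g x" and ?b = "\<lambda>(s, x). if s then x else inv g' x"
  have iff: "x = inv g y \<longleftrightarrow> g x = y" "x = inv g' y \<longleftrightarrow> g' x = y"
    "inv g y = x \<longleftrightarrow> g x = y" "inv g' y = x \<longleftrightarrow> g' x = y" for x y
    using bij_inv_eq_iff[OF assms(2), of x y] bij_inv_eq_iff[OF assms(3), of x y] by auto
  have inj: "inv g x = inv g y \<longleftrightarrow> x = y" "inv g' x = inv g' y \<longleftrightarrow> x = y" for x y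
    using assms(2,3) by (simp_all add: bij_imp_bij_inv bij_is_inj inj_eq)
  obtain h where h: "bij h" "\<And>s. s \<in> ?J \<Longrightarrow> h (?a s) = ?b s"
  proof (rule finite_family_permutation[of ?J ?a ?b])
    show "finite ?J" using assms(1) by simp
    show "?a s = ?a t \<longleftrightarrow> ?b s = ?b t" if "s \<in> ?J" "t \<in> ?J" for s t
      using ag that bij_is_surj[OF assms(2), THEN surj_f_inv_f] bij_is_surj[OF assms(3), THEN surj_f_inv_f]
      by (auto simp: agree_map_option iff inj)
  qed blast
  have hfix: "h x = x" "h (inv g x) = inv g' x" if "x \<in> F" for x
    using h(2)[of "(True, x)"] h(2)[of "(False, x)"] that by simp_all
  define b where "b = inv h"
  define a where "a = g' \<circ> h \<circ> inv g"
  have "b \<in> fixator F"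
    using hfix h(1) by (auto simp: b_def fixator_def bij_imp_bij_inv intro: inv_f_eq bij_is_inj)
  moreover have "a \<in> fixator F"
  proof -
    have "a x = x" if "x \<in> F" for x
      using hfix(2)[OF that] assms(3) by (simp add: a_def bij_is_surj surj_f_inv_f)
    moreover have "bij a"
      unfolding a_def by (intro bij_comp bij_imp_bij_inv h(1) assms(2,3))
    ultimately show ?thesis by (simp add: fixator_def)
  qed
  moreover have "g' = a \<circ> g \<circ> b"
    using h(1) assms(2) by (simp add: a_def b_def fun_eq_iff bij_is_inj bij_is_surj surj_f_inv_f)
  ultimately show thesis using that by blast
qed

text \<open>A maximal partial map that is forced for arbitrarily good pairs: beyond it the values escape
  every finite set, since otherwise one of finitely many further values would be forced as well.\<close>
lemma escaping_pairs:
  fixes B :: "(('i \<Rightarrow> 'a) \<times> ('i \<Rightarrow> 'a)) set"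
  assumes "finite F"
    and B: "\<And>E. finite E \<Longrightarrow> \<exists>(p, p') \<in> B. \<forall>y\<in>F. p y \<in> E \<or> p' y \<in> E \<longrightarrow> p y = p' y"
  obtains D c where "D \<subseteq> F"
    "\<And>E. finite E \<Longrightarrow> \<exists>(p, p') \<in> B. (\<forall>y\<in>D. p y = c y \<and> p' y = c y) \<and>
        (\<forall>y\<in>F - D. p y \<notin> E \<and> p' y \<notin> E)"
proof -
  define good where "good E pp \<longleftrightarrow> (\<forall>y\<in>F. fst pp y \<in> E \<or> snd pp y \<in> E \<longrightarrow> fst pp y = snd pp y)" for E :: "'a set" and pp :: "('i \<Rightarrow> 'a) \<times> ('i \<Rightarrow> 'a)"
  define ext where "ext D c pp \<longleftrightarrow> (\<forall>y\<in>D. fst pp y = c y \<and> snd pp y = c y)" for D c and pp :: "('i \<Rightarrow> 'a) \<times> ('i \<Rightarrow> 'a)"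
  \<comment> \<open>The order of the quantifiers is the point: one assignment \<open>c\<close> has
    to serve all finite \<open>E\<close>.\<close>
  define pers where "pers D \<longleftrightarrow> (\<exists>c. \<forall>E. finite E \<longrightarrow> (\<exists>pp\<in>B. good E pp \<and> ext D c pp))" for D
  have good_mono: "good E' pp \<Longrightarrow> E \<subseteq> E' \<Longrightarrow> good E pp" for E E' pp
    by (auto simp: good_def)
  have "pers {}"
    using B by (fastforce simp: pers_def good_def ext_def split_beta)
  then have "\<exists>D. (D \<subseteq> F \<and> pers D) \<and> (\<forall>D'. D' \<subseteq> F \<and> pers D' \<longrightarrow> card D' \<le> card D)"
    by (intro ex_has_greatest_nat[where b = "Suc (card F)" and k = "{}"])
       (use assms(1) in \<open>auto simp: less_Suc_eq_le intro: card_mono\<close>)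
  then obtain D where D: "D \<subseteq> F" "pers D" and max: "\<And>D'. D' \<subseteq> F \<Longrightarrow> pers D' \<Longrightarrow> card D' \<le> card D"
    by blast
  obtain c where c: "\<And>E. finite E \<Longrightarrow> \<exists>pp\<in>B. good E pp \<and> ext D c pp"
    using D(2) unfolding pers_def by blast
  show thesis
  proof (rule that[of D c])
    show "D \<subseteq> F" by fact
    fix E0 :: "'a set" assume E0: "finite E0"
    show "\<exists>(p, p') \<in> B. (\<forall>y\<in>D. p y = c y \<and> p' y = c y) \<and> (\<forall>y\<in>F - D. p y \<notin> E0 \<and> p' y \<notin> E0)"
    proof (rule ccontr)
      assume neg: "\<not> ?thesis"
      have "\<exists>E. finite E \<and> \<not> (\<exists>pp\<in>B. good E pp \<and> ext (insert y D) (c(y := v)) pp)"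
        if "y \<in> F - D" for y v
      proof -
        have "card (insert y D) = Suc (card D)"
          using that D(1) assms(1) by (simp add: finite_subset)
        then have "\<not> pers (insert y D)"
          using max[of "insert y D"] that D(1) by auto
        then show ?thesis unfolding pers_def by blast
      qed
      note neg_ext = this
      \<comment> \<open>A finite obstruction to forcing the further value \<open>v\<close> at
        \<open>y\<close>, available by maximality of \<open>D\<close>.\<close>
      define X where "X y v = (SOME E. finite E \<and> \<not> (\<exists>pp\<in>B. good E pp \<and> ext (insert y D) (c(y := v)) pp))" for y v
      have X: "finite (X y v)" "\<And>pp. pp \<in> B \<Longrightarrow> good (X y v) pp \<Longrightarrow> \<not> ext (insert y D) (c(y := v)) pp"
        if "y \<in> F - D" for y v
        using someI_ex[OF neg_ext[OF that, of v]] unfolding X_def[symmetric] by blast+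
      \<comment> \<open>Only values in \<open>E0\<close> at the finitely many points of
        \<open>F - D\<close> matter, so all obstructions together stay finite. A good pair for this
        set that enters \<open>E0\<close> off \<open>D\<close> takes one common value there and
        contradicts one of them.\<close>
      let ?E = "E0 \<union> (\<Union>y\<in>F - D. \<Union>v\<in>E0. X y v)"
      have "finite ?E" using E0 X(1) assms(1) by blast
      then obtain pp where pp: "pp \<in> B" "good ?E pp" "ext D c pp" using c by blast
      then obtain y where y: "y \<in> F - D" "fst pp y \<in> E0 \<or> snd pp y \<in> E0"
        using neg[unfolded split_beta] unfolding ext_def by blast
      have "good E0 pp" using good_mono[OF pp(2)] by blast
      then have eq: "snd pp y = fst pp y" "fst pp y \<in> E0"
        using y by (auto simp: good_def)
      have "good (X y (fst pp y)) pp"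
        using good_mono[OF pp(2)] y(1) eq(2) by blast
      moreover have "ext (insert y D) (c(y := fst pp y)) pp"
        using pp(3) y(1) eq(1) by (auto simp: ext_def)
      ultimately show False using X(2) y(1) pp(1) by blast
    qed
  qed
qed

text \<open>Off \<open>D\<close>, each new pair avoids every value used before, so the coincidences
  within \<open>p\<close> and within \<open>p'\<close> are the same, and some \<open>h j\<close> of
  finite support matches the two families below \<open>j\<close>. For fixed \<open>j\<close>, the
  values off \<open>D\<close> are distinct for distinct \<open>i\<close> and so leave that support,
  while those on \<open>D\<close> are constants fixed by \<open>h j\<close>.\<close>

lemma escaping_sequence:
  fixes B :: "(('i \<Rightarrow> 'a) \<times> ('i \<Rightarrow> 'a)) set"
  assumes F: "finite F"
    and inj: "\<And>p p'. (p, p') \<in> B \<Longrightarrow> inj_on p F \<and> inj_on p' F"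
    and B: "\<And>E. finite E \<Longrightarrow> \<exists>(p, p') \<in> B. \<forall>y\<in>F. p y \<in> E \<or> p' y \<in> E \<longrightarrow> p y = p' y"
  obtains p p' :: "nat \<Rightarrow> 'i \<Rightarrow> 'a" and h :: "nat \<Rightarrow> 'a \<Rightarrow> 'a" where
    "\<And>i. (p i, p' i) \<in> B" "\<And>j. bij (h j)"
    "\<And>i j y. i < j \<Longrightarrow> y \<in> F \<Longrightarrow> h j (p' i y) = p i y"
    "\<And>j. 0 < j \<Longrightarrow> \<exists>n. \<forall>i\<ge>n. \<forall>y\<in>F. h j (p i y) = p i y"
proof -
  obtain D c where D: "D \<subseteq> F"
    and ex: "\<And>E. finite E \<Longrightarrow> \<exists>(p, p') \<in> B. (\<forall>y\<in>D. p y = c y \<and> p' y = c y) \<and>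
        (\<forall>y\<in>F - D. p y \<notin> E \<and> p' y \<notin> E)"
    using escaping_pairs[OF F B] by blast
  have "\<forall>E. \<exists>s. finite E \<longrightarrow> s \<in> B \<and> (\<forall>y\<in>D. fst s y = c y \<and> snd s y = c y) \<and>
        (\<forall>y\<in>F - D. fst s y \<notin> E \<and> snd s y \<notin> E)"
    using ex[unfolded split_beta] by blast
  from choice[OF this] obtain S where S: "\<And>E. finite E \<Longrightarrow> S E \<in> B"
    "\<And>E y. finite E \<Longrightarrow> y \<in> D \<Longrightarrow> fst (S E) y = c y \<and> snd (S E) y = c y"
    "\<And>E y. finite E \<Longrightarrow> y \<in> F - D \<Longrightarrow> fst (S E) y \<notin> E \<and> snd (S E) y \<notin> E"
    by blast
  \<comment> \<open>Starting from the image of \<open>D\<close> keeps the escaping values away from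
    the constants as well.\<close>
  define E where "E = rec_nat (c ` D) (\<lambda>_ X. X \<union> fst (S X) ` F \<union> snd (S X) ` F)"
  have E0: "E 0 = c ` D" and E_Suc: "E (Suc n) = E n \<union> fst (S (E n)) ` F \<union> snd (S (E n)) ` F" for n
    by (simp_all add: E_def)
  have fin: "finite (E n)" for n
    by (induction n) (use F D in \<open>auto simp: E0 E_Suc intro: finite_subset\<close>)
  have mono: "E i \<subseteq> E j" if "i \<le> j" for i j
    using that by (rule lift_Suc_mono_le[rotated]) (auto simp: E_Suc)
  define p p' where "p n = fst (S (E n))" and "p' n = snd (S (E n))" for n
  have pB: "(p n, p' n) \<in> B" for n using S(1)[OF fin] by (simp add: p_def p'_def)
  have pD: "p n y = c y" "p' n y = c y" if "y \<in> D" for n y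
    using S(2)[OF fin that] by (auto simp: p_def p'_def)
  have esc: "p n y \<notin> E n" "p' n y \<notin> E n" if "y \<in> F" "y \<notin> D" for n y
    using S(3)[OF fin] that by (auto simp: p_def p'_def)
  have inE: "p n y \<in> E (Suc n)" "p' n y \<in> E (Suc n)" if "y \<in> F" for n y
    using that by (auto simp: E_Suc p_def p'_def)
  have inE': "p i y \<in> E n" "p' i y \<in> E n" if "y \<in> F" "i < n \<or> y \<in> D" for i n y
  proof -
    have "p i y \<in> E n \<and> p' i y \<in> E n"
    proof (cases "y \<in> D")
      case True then show ?thesis using mono[of 0 n] by (auto simp: E0 pD)
    next
      case False 
      then have "E (Suc i) \<subseteq> E n" using that by (intro mono) auto
      then show ?thesis using inE[OF that(1)] by blast
    qed
    then show "p i y \<in> E n" "p' i y \<in> E n" by auto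
  qed
  \<comment> \<open>The right-hand side does not mention \<open>q\<close>: this is the common
    equality pattern of \<open>p\<close> and \<open>p'\<close>.\<close>
  have key: "q i y = q k z \<longleftrightarrow> (i = k \<or> y \<in> D) \<and> y = z"
    if q: "q = p \<or> q = p'" and yz: "y \<in> F" "z \<in> F" for q i k y z
  proof -
    have qinj: "inj_on (q i) F" for i using q inj[OF pB] by blast
    have qD: "q i y = c y" if "y \<in> D" for i y using q pD that by auto
    have esc': "q n y \<notin> E n" if "y \<in> F" "y \<notin> D" for n y using q esc that by auto
    have inE'': "q i y \<in> E n" if "y \<in> F" "i < n \<or> y \<in> D" for i n y using q inE' that by auto
    show ?thesis
    proof
      assume eq: "q i y = q k z"
      have ik: "i = k \<or> y \<in> D"
      proof (rule ccontr)
        assume no: "\<not> (i = k \<or> y \<in> D)"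
        then consider "z \<in> D" | "z \<notin> D" "i < k" | "k < i" by linarith
        then show False
        proof cases
          case 1 then show False using inE''[of z k i] esc'[of y i] no eq yz by auto
        next
          case 2 then show False using inE''[of y i k] esc'[of z k] eq yz by auto
        next
          case 3 then show False using inE''[of z k i] esc'[of y i] no eq yz by auto
        qed
      qed
      then have "q k y = q k z" using eq qD[of y] by metis
      then have "y = z" using qinj yz by (simp add: inj_on_def)
      with ik show "(i = k \<or> y \<in> D) \<and> y = z" by blast
    next
      assume "(i = k \<or> y \<in> D) \<and> y = z"
      then show "q i y = q k z" using qD[of y] by auto
    qed
  qed
  have "\<exists>h. bij h \<and> finite {x. h x \<noteq> x} \<and> (\<forall>i<j. \<forall>y\<in>F. h (p' i y) = p i y)" for j
  proof -
    obtain h where h: "bij h" "finite {x. h x \<noteq> x}" "\<And>s. s \<in> {..<j} \<times> F \<Longrightarrow> h ((\<lambda>(i,y). p' i y) s) = (\<lambda>(i,y). p i y) s"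
      by (rule finite_family_permutation[of "{..<j} \<times> F" "\<lambda>(i,y). p' i y" "\<lambda>(i,y). p i y"])
         (use F key in auto)
    then have "h (p' i y) = p i y" if "i < j" "y \<in> F" for i y
      using h(3)[of "(i, y)"] that by simp
    then show ?thesis using h by blast
  qed
  then obtain h where h: "\<And>j. bij (h j)" "\<And>j. finite {x. h j x \<noteq> x}"
    "\<And>j i y. i < j \<Longrightarrow> y \<in> F \<Longrightarrow> h j (p' i y) = p i y" by metis
  show thesis
  proof (rule that[of p p' h])
    fix j :: nat assume "0 < j"
    \<comment> \<open>The condition for index 0 is available only if \<open>0 < j\<close>; as both
      families equal \<open>c\<close> on \<open>D\<close>, it says that \<open>h j\<close> fixes
      these constants.\<close>
    have hc: "h j (c y) = c y" if "y \<in> D" for y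
      using h(3)[OF \<open>0 < j\<close>, of y] that D pD by auto
    have unique: "finite {i. p i y = v}" if "y \<in> F" "y \<notin> D" for y v
    proof -
      have "i = k" if "p i y = v" "p k y = v" for i k
        using key[of p y y i k] that \<open>y \<in> F\<close> \<open>y \<notin> D\<close> by simp
      then have "\<exists>k. {i. p i y = v} \<subseteq> {k}" by blast
      then show ?thesis using finite_subset by blast
    qed
    have "finite (\<Union>y\<in>F - D. \<Union>v\<in>{x. h j x \<noteq> x}. {i. p i y = v})"
      using unique F h(2) by auto
    then obtain n where n: "\<forall>i\<in>(\<Union>y\<in>F - D. \<Union>v\<in>{x. h j x \<noteq> x}. {i. p i y = v}). i < n"
      using finite_nat_set_iff_bounded by blast
    have "h j (p i y) = p i y" if "n \<le> i" "y \<in> F" for i y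
    proof (cases "y \<in> D")
      case True then show ?thesis by (simp add: pD hc)
    next
      case False
      show ?thesis
      proof (rule ccontr)
        assume "h j (p i y) \<noteq> p i y"
        then have "i < n" using n that(2) False by blast
        then show False using that(1) by simp
      qed
    qed
    then show "\<exists>n. \<forall>i\<ge>n. \<forall>y\<in>F. h j (p i y) = p i y" by blast
  qed (use pB h in auto)
qed


section \<open>The topologies\<close>

lemma alexandroff_eq_Alexandroff_compactification:
  "alexandroff T = Alexandroff_compactification T"
proof -
  have "(\<lambda>U. U \<subseteq> insert None (Some ` topspace T) \<and>
      (None \<notin> U \<longrightarrow> openin T (Some -` U)) \<and>
      (None \<in> U \<longrightarrow> compactin T (topspace T - Some -` U) \<and> closedin T (topspace T - Some -` U)))
    = openin (Alexandroff_compactification T)" (is "?P = _")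
  proof
    fix U
    show "?P U = openin (Alexandroff_compactification T) U"
    proof
      assume U: "?P U"
      show "openin (Alexandroff_compactification T) U"
      proof (cases "None \<in> U")
        case True
        have "U = insert None (Some ` (topspace T - (topspace T - Some -` U)))"
          using U True by (auto simp: image_iff) 
        then show ?thesis
          using U True by (auto simp: openin_Alexandroff_compactification)
      next
        case False
        have "U = Some ` (Some -` U)" using U False by auto
        then show ?thesis
          using U False by (metis openin_Alexandroff_compactification)
      qed
    next
      assume "openin (Alexandroff_compactification T) U"
      then consider V where "openin T V" "U = Some ` V"
        | C where "compactin T C" "closedin T C" "U = insert None (Some ` (topspace T - C))"
        by (auto simp: openin_Alexandroff_compactification)
      then show "?P U"
      proof cases
        case 1
        then show ?thesis
          using openin_subset[of T V] by (auto simp: inj_vimage_image_eq)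
      next
        case 2
        then have "topspace T - Some -` U = C"
          using closedin_subset[of T C] by auto
        with 2 show ?thesis by auto
      qed
    qed
  qed
  then show ?thesis
    unfolding alexandroff_def by (simp add: openin_inverse)
qed

lemma image_Some_vimage: "None \<notin> V \<Longrightarrow> Some ` (Some -` V) = V"
  by (simp add: image_vimage_eq) (metis UNIV_option_conv insert_iff inf.orderE subsetI UNIV_I)

lemma openin_alphaX: "openin alphaX U \<longleftrightarrow> (None \<in> U \<longrightarrow> finite (- U))"
proof (cases "None \<in> U")
  case True
  then have eq: "- U = Some ` (- Some -` U)"
    using image_Some_vimage[of "- U"] by (simp add: vimage_Compl)
  then have "finite (- U) \<longleftrightarrow> finite (- Some -` U)"
    by (metis finite_image_iff inj_Some)
  moreover have "openin alphaX U \<longleftrightarrow> finite (- Some -` U)"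
  proof
    assume "openin alphaX U"
    then obtain C where "finite C" "U = insert None (Some ` (UNIV - C))"
      using True by (auto simp: alexandroff_eq_Alexandroff_compactification openin_Alexandroff_compactification compactin_discrete_topology)
    moreover from this have "- Some -` U = C" by auto
    ultimately show "finite (- Some -` U)" by simp
  next
    assume "finite (- Some -` U)"
    moreover have "U = insert None (Some ` (UNIV - (- Some -` U)))"
    proof -
      have "U - {None} = Some ` (Some -` U)"
        using image_Some_vimage[of "U - {None}"] by (simp add: vimage_Diff vimage_def)
      then show ?thesis using True by (auto simp: Compl_eq_Diff_UNIV[symmetric])
    qed
    ultimately show "openin alphaX U"
      unfolding alexandroff_eq_Alexandroff_compactification openin_Alexandroff_compactification
      by (intro disjI2 exI[of _ "- Some -` U"]) (simp add: compactin_discrete_topology)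
  qed
  ultimately show ?thesis using True by simp
next
  case False
  have "openin alphaX (Some ` (Some -` U))"
    unfolding alexandroff_eq_Alexandroff_compactification openin_Alexandroff_compactification_image_Some by simp
  then show ?thesis using False unfolding image_Some_vimage[OF False] by simp
qed

lemma topspace_alphaX [simp]: "topspace alphaX = UNIV"
  by (simp add: alexandroff_eq_Alexandroff_compactification UNIV_option_conv)

lemma compact_space_alphaX: "compact_space alphaX"
  by (simp add: alexandroff_eq_Alexandroff_compactification)

lemma openin_alphaX_Some: "openin alphaX {Some y}"
  and closedin_alphaX_Some: "closedin alphaX {Some y}"
  by (simp_all add: openin_alphaX closedin_def Compl_eq_Diff_UNIV[symmetric])

lemma Hausdorff_space_alphaX: "Hausdorff_space alphaX"
  unfolding Hausdorff_space_def
proof (intro allI impI)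
  fix u v :: "'a option"
  assume uv: "u \<in> topspace alphaX \<and> v \<in> topspace alphaX \<and> u \<noteq> v"
  have *: "\<exists>U V. openin alphaX U \<and> openin alphaX V \<and> Some y \<in> U \<and> w \<in> V \<and> disjnt U V"
    if "w \<noteq> Some y" for w and y :: 'a
    using that by (intro exI[of _ "{Some y}"] exI[of _ "- {Some y}"]) (auto simp: openin_alphaX disjnt_def)
  show "\<exists>U V. openin alphaX U \<and> openin alphaX V \<and> u \<in> U \<and> v \<in> V \<and> disjnt U V"
  proof (cases u)
    case (Some y)
    then show ?thesis using *[of v y] uv by auto
  next
    case None
    then obtain y where "v = Some y" using uv by (cases v) auto
    then show ?thesis using *[of u y] uv disjnt_sym by blast
  qed
qed

text \<open>An open set without \<open>None\<close> is a union of isolated points, and one with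
  \<open>None\<close> is the complement of finitely many of them, so the fibres over the points
  \<open>Some y\<close> decide continuity.\<close>

lemma continuous_map_into_alphaX:
  assumes "\<And>y. openin S {s \<in> topspace S. f s = Some y}"
    and "\<And>y. closedin S {s \<in> topspace S. f s = Some y}"
  shows "continuous_map S alphaX f"
  unfolding continuous_map_def
proof (intro conjI allI impI)
  fix U :: "'a option set" assume U: "openin alphaX U"
  show "openin S {s \<in> topspace S. f s \<in> U}"
  proof (cases "None \<in> U")
    case True
    then obtain C where C: "- U = Some ` C"
      using image_Some_vimage[of "- U"] by (metis ComplD)
    then have "finite C" using U True by (metis finite_image_iff inj_Some openin_alphaX)
    then have "closedin S (\<Union>y\<in>C. {s \<in> topspace S. f s = Some y})"
      using assms(2) by (intro closedin_Union) auto
    moreover have "topspace S - (\<Union>y\<in>C. {s \<in> topspace S. f s = Some y}) = {s \<in> topspace S. f s \<in> U}"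
      using C by blast
    ultimately show ?thesis unfolding closedin_def by simp
  next
    case False
    have "openin S (\<Union>y\<in>Some -` U. {s \<in> topspace S. f s = Some y})"
      using assms(1) by (intro openin_Union) auto
    moreover have "(\<Union>y\<in>Some -` U. {s \<in> topspace S. f s = Some y}) = {s \<in> topspace S. f s \<in> U}"
    proof -
      have "\<exists>y. f s = Some y" if "f s \<in> U" for s
        using that False by (cases "f s") auto
      then show ?thesis by fastforce
    qed
    ultimately show ?thesis by simp
  qed
qed auto

section \<open>The topology of the permutation group\<close>

lemma topspace_perm_top [simp]: "topspace perm_top = {g. bij g}"
  by (auto simp: perm_top_def)

lemma openin_perm_top:
  "openin perm_top U \<longleftrightarrow>
     U \<subseteq> {g. bij g} \<and> (\<forall>g\<in>U. \<exists>F. finite F \<and> {g'. bij g' \<and> (\<forall>x\<in>F. g' x = g x)} \<subseteq> U)"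
proof
  assume "openin perm_top U"
  then obtain T where T: "openin (product_topology (\<lambda>_. discrete_topology UNIV) UNIV) T" "U = T \<inter> {f. bij f}"
    by (auto simp: perm_top_def openin_subtopology)
  have "\<exists>F. finite F \<and> {g'. bij g' \<and> (\<forall>x\<in>F. g' x = g x)} \<subseteq> U" if gU: "g \<in> U" for g
  proof -
    have "\<forall>x\<in>T. \<exists>V. finite {i. V i \<noteq> UNIV} \<and> x \<in> Pi\<^sub>E UNIV V \<and> Pi\<^sub>E UNIV V \<subseteq> T"
      using T(1) by (simp add: openin_product_topology_alt)
    then obtain V where V: "finite {i. V i \<noteq> UNIV}" "g \<in> Pi\<^sub>E UNIV V" "Pi\<^sub>E UNIV V \<subseteq> T"
      using gU T(2) by (meson IntD1)
    show ?thesis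
    proof (intro exI conjI subsetI)
      fix g' assume g': "g' \<in> {g'. bij g' \<and> (\<forall>x\<in>{i. V i \<noteq> UNIV}. g' x = g x)}"
      have "g' i \<in> V i" for i
        using g' V(2) by (cases "V i = UNIV") (auto simp: PiE_iff)
      then show "g' \<in> U" using V(3) g' T(2) by (auto simp: PiE_iff)
    qed (use V in auto)
  qed
  then show "U \<subseteq> {g. bij g} \<and> (\<forall>g\<in>U. \<exists>F. finite F \<and> {g'. bij g' \<and> (\<forall>x\<in>F. g' x = g x)} \<subseteq> U)"
    using T(2) by blast
next
  assume *: "U \<subseteq> {g. bij g} \<and> (\<forall>g\<in>U. \<exists>F. finite F \<and> {g'. bij g' \<and> (\<forall>x\<in>F. g' x = g x)} \<subseteq> U)"
  show "openin perm_top U"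
  proof (subst openin_subopen, intro ballI)
    fix g assume "g \<in> U"
    then obtain F where F: "finite F" "{g'. bij g' \<and> (\<forall>x\<in>F. g' x = g x)} \<subseteq> U" "bij g" using * by blast
    have "openin (product_topology (\<lambda>_. discrete_topology UNIV) UNIV) (Pi\<^sub>E UNIV (\<lambda>i. if i \<in> F then {g i} else UNIV))"
      using F(1) by (auto simp: openin_PiE_gen intro: finite_subset)
    then have "openin perm_top (Pi\<^sub>E UNIV (\<lambda>i. if i \<in> F then {g i} else UNIV) \<inter> {f. bij f})"
      unfolding perm_top_def by (rule openin_subtopology_Int)
    moreover have "Pi\<^sub>E UNIV (\<lambda>i. if i \<in> F then {g i} else UNIV) \<inter> {f. bij f} = {g'. bij g' \<and> (\<forall>x\<in>F. g' x = g x)}"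
      by (auto simp: PiE_iff split: if_splits)
    ultimately show "\<exists>T. openin perm_top T \<and> g \<in> T \<and> T \<subseteq> U" using F by auto
  qed
qed

lemma openin_perm_top_fixator: "finite F \<Longrightarrow> openin perm_top (fixator F)"
  by (auto simp: openin_perm_top fixator_def intro!: exI[of _ F])

lemma openin_perm_top_value: "openin perm_top {g. bij g \<and> g x = y}"
  by (auto simp: openin_perm_top intro!: exI[of _ "{x}"])

lemma fixator_subset_if_openin:
  assumes "openin perm_top U" "id \<in> U"
  obtains F where "finite F" "fixator F \<subseteq> U"
  using assms that by (fastforce simp: openin_perm_top fixator_def)

section \<open>The compact space of partial injections\<close>

abbreviation (input) pinj_top :: "('a option \<Rightarrow> 'a option) topology" where
  "pinj_top \<equiv> subtopology (product_topology (\<lambda>_. alphaX) UNIV) pinj_maps"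

text \<open>The set \<open>Y\<close> is recovered as the set where \<open>f\<close> is finite, and
  the last clause of the definition forces \<open>f None = None\<close> because \<open>None\<close>
  lies outside every image of \<open>Some\<close>. In this form the failure of membership is an open
  condition.\<close>

lemma pinj_maps_iff:
  "f \<in> pinj_maps \<longleftrightarrow> f None = None \<and> (\<forall>x x' y. f (Some x) = Some y \<and> f (Some x') = Some y \<longrightarrow> x = x')"
proof
  assume "f \<in> pinj_maps"
  then obtain Y where Y: "inj_on f (Some ` Y)" "f ` (Some ` Y) \<subseteq> Some ` UNIV" "f ` (UNIV - Some ` Y) = {None}"
    by (auto simp: pinj_maps_def)
  then have none: "f w = None" if "w \<notin> Some ` Y" for w using that by blast
  have "x = x'" if "f (Some x) = Some y" "f (Some x') = Some y" for x x' y
  proof -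
    have "Some x \<in> Some ` Y" "Some x' \<in> Some ` Y"
      using that none[of "Some x"] none[of "Some x'"] by force+
    then show ?thesis using inj_onD[OF Y(1), of "Some x" "Some x'"] that by simp
  qed
  then show "f None = None \<and> (\<forall>x x' y. f (Some x) = Some y \<and> f (Some x') = Some y \<longrightarrow> x = x')"
    using none[of None] by blast
next
  assume *: "f None = None \<and> (\<forall>x x' y. f (Some x) = Some y \<and> f (Some x') = Some y \<longrightarrow> x = x')"
  let ?Y = "{x. f (Some x) \<noteq> None}"
  have "inj_on f (Some ` ?Y)" using * by (auto simp: inj_on_def)
  moreover have "f ` (Some ` ?Y) \<subseteq> Some ` UNIV" by auto
  moreover have "f ` (UNIV - Some ` ?Y) = {None}"
  proof -
    have "f ` (UNIV - Some ` ?Y) \<subseteq> {None}"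
    proof (rule image_subsetI)
      fix w assume "w \<in> UNIV - Some ` ?Y"
      then show "f w \<in> {None}" using * by (cases w) auto
    qed
    moreover have "{None} \<subseteq> f ` (UNIV - Some ` ?Y)"
      using * by (auto intro!: image_eqI[of _ _ None])
    ultimately show ?thesis by (rule subset_antisym)
  qed
  ultimately show "f \<in> pinj_maps"
    unfolding pinj_maps_def by (intro CollectI exI[of _ ?Y] conjI)
qed

lemma topspace_pinj_top [simp]: "topspace pinj_top = pinj_maps"
  by auto

lemma pinj_None: "f \<in> pinj_maps \<Longrightarrow> f None = None"
  and pinj_inj: "f \<in> pinj_maps \<Longrightarrow> f (Some x) = Some y \<Longrightarrow> f (Some x') = Some y \<Longrightarrow> x = x'"
  by (auto simp: pinj_maps_iff)

lemma map_option_pinj: "bij g \<Longrightarrow> map_option g \<in> pinj_maps"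
  by (auto simp: pinj_maps_iff bij_def inj_def)

lemma clopen_pinj_value:
  "openin pinj_top {f \<in> pinj_maps. f w = Some y}" "closedin pinj_top {f \<in> pinj_maps. f w = Some y}"
proof -
  have c: "continuous_map pinj_top alphaX (\<lambda>f. f w)"
    by (intro continuous_map_from_subtopology continuous_map_product_projection) simp
  show "openin pinj_top {f \<in> pinj_maps. f w = Some y}"
    using openin_continuous_map_preimage[OF c openin_alphaX_Some[of y]] by simp
  show "closedin pinj_top {f \<in> pinj_maps. f w = Some y}"
    using closedin_continuous_map_preimage[OF c closedin_alphaX_Some[of y]] by simp
qed

lemma continuous_map_into_pinj_top:
  assumes "\<And>s. s \<in> topspace S \<Longrightarrow> h s \<in> pinj_maps"
    and "\<And>x y. openin S {s \<in> topspace S. h s (Some x) = Some y}"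
    and "\<And>x y. closedin S {s \<in> topspace S. h s (Some x) = Some y}"
  shows "continuous_map S pinj_top h"
  unfolding continuous_map_in_subtopology continuous_map_componentwise_UNIV
proof (intro conjI allI)
  fix w
  show "continuous_map S alphaX (\<lambda>s. h s w)"
  proof (cases w)
    case None
    have empty: "{s \<in> topspace S. h s None = Some y} = {}" for y
      using assms(1) pinj_None by fastforce
    show ?thesis
      unfolding None by (intro continuous_map_into_alphaX) (simp_all only: empty openin_empty closedin_empty)
  next
    case (Some x)
    show ?thesis unfolding Some by (intro continuous_map_into_alphaX assms)
  qed
qed (use assms(1) in auto)

text \<open>Agreement with \<open>z\<close> prescribes finitely many conditions
  \<open>f (Some x) = Some y\<close> or their negations, and such conditions are clopen.\<close>

lemma openin_agree:
  assumes "finite F"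
  shows "openin pinj_top {f \<in> pinj_maps. agree F z f}"
proof -
  have eq: "{f \<in> pinj_maps. agree F z f} =
      topspace pinj_top \<inter> (\<Inter>(x,y)\<in>F \<times> F. if z (Some x) = Some y then {f \<in> pinj_maps. f (Some x) = Some y}
         else topspace pinj_top - {f \<in> pinj_maps. f (Some x) = Some y})"
    by (auto simp: agree_def split: if_splits)
  have *: "openin pinj_top (topspace pinj_top \<inter> \<Inter>(I ` J))" if "finite J" "\<And>j. j \<in> J \<Longrightarrow> openin pinj_top (I j)" for J :: "('a \<times> 'a) set" and I
    using that
  proof (induction J rule: finite_induct)
    case (insert j J)
    have "openin pinj_top (I j \<inter> (topspace pinj_top \<inter> \<Inter>(I ` J)))"
      by (rule openin_Int[OF insert.prems insert.IH]) (use insert.prems in simp_all)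
    moreover have "I j \<inter> (topspace pinj_top \<inter> \<Inter>(I ` J)) = topspace pinj_top \<inter> \<Inter>(I ` insert j J)"
      by blast
    ultimately show ?case by (simp only:)
  qed (simp del: topspace_pinj_top topspace_subtopology)
  show ?thesis
    unfolding eq by (rule *) (use assms clopen_pinj_value in \<open>auto simp del: topspace_subtopology topspace_pinj_top intro!: openin_diff\<close>)
qed

text \<open>These sets form a neighbourhood base although they ignore where points leave
  \<open>F\<close>: a neighbourhood of the value \<open>None\<close> excludes only finitely many
  points, which can be put into \<open>F\<close>, and a finite value is pinned down by putting it
  into \<open>F\<close>.\<close>

lemma openin_pinj_top:
  "openin pinj_top U \<longleftrightarrow>
     U \<subseteq> pinj_maps \<and> (\<forall>z\<in>U. \<exists>F. finite F \<and> {f \<in> pinj_maps. agree F z f} \<subseteq> U)"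
proof
  assume "openin pinj_top U"
  then obtain T where T: "openin (product_topology (\<lambda>_. alphaX) UNIV) T" "U = T \<inter> pinj_maps"
    by (auto simp: openin_subtopology)
  have "\<exists>F. finite F \<and> {f \<in> pinj_maps. agree F z f} \<subseteq> U" if zU: "z \<in> U" for z
  proof -
    have "\<forall>x\<in>T. \<exists>V. finite {i. V i \<noteq> UNIV} \<and> (\<forall>i. openin alphaX (V i)) \<and> x \<in> Pi\<^sub>E UNIV V \<and> Pi\<^sub>E UNIV V \<subseteq> T"
      using T(1) by (simp add: openin_product_topology_alt)
    then obtain V where V: "finite {i. V i \<noteq> UNIV}" "\<And>i. openin alphaX (V i)" "z \<in> Pi\<^sub>E UNIV V" "Pi\<^sub>E UNIV V \<subseteq> T"
      using zU T(2) by (meson IntD1)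
    have zV: "z i \<in> V i" for i using V(3) by (auto simp: PiE_iff)
    have "\<exists>F. finite F \<and> (\<forall>f\<in>pinj_maps. agree F z f \<longrightarrow> f i \<in> V i)" for i
    proof (cases i)
      case None
      then show ?thesis using zV[of i] zU T(2) by (intro exI[of _ "{}"]) (auto simp: pinj_None)
    next
      case (Some x)
      show ?thesis
      proof (cases "z i")
        case None
        then have "finite (- V i)" using V(2)[of i] zV[of i] by (simp add: openin_alphaX)
        then have "finite (insert x (Some -` (- V i)))" by (simp add: finite_vimageI)
        moreover have "f i \<in> V i" if "agree (insert x (Some -` (- V i))) z f" for f
        proof (rule ccontr)
          assume no: "f i \<notin> V i"
          then obtain y where "f i = Some y" using zV[of i] None by (cases "f i") auto
          with that no Some None show False by (auto simp: agree_def)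
        qed
        ultimately show ?thesis by blast
      next
        case (Some y)
        then have "f i = z i" if "agree {x, y} z f" for f
          using that \<open>i = Some x\<close> by (auto simp: agree_def)
        then show ?thesis using zV[of i] by (intro exI[of _ "{x, y}"]) auto
      qed
    qed
    then obtain F where F: "\<And>i. finite (F i)" "\<And>i f. f \<in> pinj_maps \<Longrightarrow> agree (F i) z f \<Longrightarrow> f i \<in> V i"
      by metis
    let ?F = "\<Union>i\<in>{i. V i \<noteq> UNIV}. F i"
    have "f \<in> U" if "f \<in> pinj_maps" "agree ?F z f" for f
    proof -
      have "f i \<in> V i" for i
      proof (cases "V i = UNIV")
        case False
        then have "agree (F i) z f" by (intro agree_mono[OF that(2)]) auto
        then show ?thesis using F(2) that(1) by blast
      qed simp
      then show ?thesis using V(4) T(2) that(1) by (auto simp: PiE_iff)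
    qed
    moreover have "finite ?F" using V(1) F(1) by blast
    ultimately show ?thesis by blast
  qed
  then show "U \<subseteq> pinj_maps \<and> (\<forall>z\<in>U. \<exists>F. finite F \<and> {f \<in> pinj_maps. agree F z f} \<subseteq> U)"
    using T(2) by blast
next
  assume *: "U \<subseteq> pinj_maps \<and> (\<forall>z\<in>U. \<exists>F. finite F \<and> {f \<in> pinj_maps. agree F z f} \<subseteq> U)"
  show "openin pinj_top U"
  proof (subst openin_subopen, intro ballI)
    fix z assume "z \<in> U"
    then obtain F where "finite F" "{f \<in> pinj_maps. agree F z f} \<subseteq> U" "z \<in> pinj_maps" using * by blast
    then show "\<exists>T. openin pinj_top T \<and> z \<in> T \<and> T \<subseteq> U"
      using openin_agree[of F z] agree_refl[of F z] by blast
  qed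
qed

text \<open>Each way of lying outside the set is witnessed by one or two finite values, and a finite
  value persists nearby because its point is isolated.\<close>

lemma closedin_pinj_maps: "closedin (product_topology (\<lambda>_. alphaX) UNIV) pinj_maps"
proof -
  let ?P = "product_topology (\<lambda>_. alphaX) UNIV :: ('a option \<Rightarrow> 'a option) topology"
  have c: "continuous_map ?P alphaX (\<lambda>f. f w)" for w
    by (rule continuous_map_product_projection) simp
  have op: "openin ?P {f. f w = Some y}" for w y
    using openin_continuous_map_preimage[OF c openin_alphaX_Some[of y]] by simp
  have "- (pinj_maps :: ('a option \<Rightarrow> 'a option) set) = (\<Union>y. {f. f None = Some y}) \<union>
      (\<Union>(x, x', y)\<in>{(x, x', y). x \<noteq> x'}. {f. f (Some x) = Some y} \<inter> {f. f (Some x') = Some y})"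
    by (auto simp: pinj_maps_iff; metis)
  moreover have "openin ?P \<dots>"
    by (intro openin_Un openin_Union) (auto intro!: op openin_Int)
  ultimately have "openin ?P (- pinj_maps)" by (simp only:)
  then show ?thesis by (simp add: closedin_def Compl_eq_Diff_UNIV)
qed

lemma compact_space_pinj_top: "compact_space pinj_top"
proof -
  have "compact_space (product_topology (\<lambda>_. alphaX) UNIV)"
    by (simp add: compact_space_product_topology compact_space_alphaX)
  then show ?thesis
    using closedin_pinj_maps closedin_compact_space compact_space_subtopology by blast
qed

lemma Hausdorff_space_pinj_top: "Hausdorff_space pinj_top"
  by (simp add: Hausdorff_space_subtopology Hausdorff_space_product_topology Hausdorff_space_alphaX)

text \<open>Infinity of the space enters here: points that \<open>z\<close> does not map into
  \<open>F\<close> are sent injectively into a fresh set \<open>R\<close> disjoint from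
  \<open>F\<close>, so no new pair appears in \<open>F\<close> x \<open>F\<close>.\<close>

lemma permutation_agreeing:
  assumes inf: "infinite (UNIV :: 'a set)" and F: "finite (F :: 'a set)" and z: "z \<in> pinj_maps"
  obtains g where "bij g" "agree F z (map_option g)"
proof -
  have "infinite (UNIV - F)" using inf F by simp
  then obtain R where R: "finite R" "card R = card F" "R \<subseteq> UNIV - F"
    by (meson infinite_arbitrarily_large)
  then obtain r where r: "bij_betw r F R" using F finite_same_card_bij by metis
  have rF: "r x \<notin> F" if "x \<in> F" for x using r R(3) that by (auto simp: bij_betw_def)
  define q where "q x = (if \<exists>y\<in>F. z (Some x) = Some y then the (z (Some x)) else r x)" for x
  have "inj_on q F"
  proof (rule inj_onI)
    fix x y assume xy: "x \<in> F" "y \<in> F" "q x = q y"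
    show "x = y"
    proof (cases "\<exists>v\<in>F. z (Some x) = Some v")
      case True
      then obtain v where v: "v \<in> F" "z (Some x) = Some v" by blast
      then have qx: "q x = v" by (simp add: q_def)
      then have "\<exists>w\<in>F. z (Some y) = Some w"
        using xy rF[of y] v(1) by (cases "\<exists>w\<in>F. z (Some y) = Some w") (simp_all add: q_def)
      then have "z (Some y) = Some v" using qx xy(3) by (auto simp: q_def)
      then show ?thesis using pinj_inj[OF z v(2)] by simp
    next
      case False
      then have qx: "q x = r x" by (simp add: q_def)
      then have no: "\<not> (\<exists>w\<in>F. z (Some y) = Some w)"
        using xy rF[of x] by (auto simp: q_def)
      then have "r x = r y" using qx xy(3) by (simp add: q_def)
      then show ?thesis using bij_betw_imp_inj_on[OF r] xy by (simp add: inj_on_def)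
    qed
  qed
  then obtain g where g: "bij g" "\<And>x. x \<in> F \<Longrightarrow> g x = q x"
    using finite_inj_extends_to_permutation[OF F] by blast
  have "z (Some x) = Some y \<longleftrightarrow> q x = y" if "x \<in> F" "y \<in> F" for x y
    using that rF[of x] by (cases "\<exists>v\<in>F. z (Some x) = Some v") (auto simp: q_def)
  then have "agree F z (map_option g)" by (simp add: agree_def g(2))
  with g(1) show thesis using that by blast
qed

lemma pinj_closure_of_permutations:
  assumes "infinite (UNIV :: 'a set)"
  shows "pinj_top closure_of (map_option ` {g :: 'a \<Rightarrow> 'a. bij g}) = pinj_maps"
proof
  show "pinj_maps \<subseteq> pinj_top closure_of (map_option ` {g :: 'a \<Rightarrow> 'a. bij g})"
  proof
    fix z :: "'a option \<Rightarrow> 'a option" assume z: "z \<in> pinj_maps"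
    have "\<exists>y. y \<in> map_option ` {g. bij g} \<and> y \<in> T" if T: "z \<in> T" "openin pinj_top T" for T
    proof -
      obtain F where "finite F" "{f \<in> pinj_maps. agree F z f} \<subseteq> T"
        using T unfolding openin_pinj_top by blast
      moreover obtain g where "bij g" "agree F z (map_option g)"
        using permutation_agreeing[OF assms \<open>finite F\<close> z] by blast
      ultimately show ?thesis using map_option_pinj by blast
    qed
    then show "z \<in> pinj_top closure_of (map_option ` {g. bij g})"
      using z by (auto simp: in_closure_of)
  qed
  show "pinj_top closure_of (map_option ` {g :: 'a \<Rightarrow> 'a. bij g}) \<subseteq> pinj_maps"
    using closure_of_subset_topspace[of pinj_top] by (simp only: topspace_pinj_top)
qed

lemma env_map_eq: "env_map alphaX (\<lambda>g. map_option g) = map_option"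
  by (simp add: env_map_def fun_eq_iff)

text \<open>The permutations are dense in the closed set \<open>pinj_maps\<close>, so it is their
  closure. All statements about the enveloping monoid thereby concern one concrete space.\<close>

lemma env_top_eq:
  assumes "infinite (UNIV :: 'a set)"
  shows "env_top alphaX (\<lambda>g. map_option g) (topspace perm_top) = (pinj_top :: ('a option \<Rightarrow> 'a option) topology)"
proof -
  let ?P = "product_topology (\<lambda>_. alphaX) UNIV :: ('a option \<Rightarrow> 'a option) topology"
  let ?S = "map_option ` {g :: 'a \<Rightarrow> 'a. bij g}"
  have "?S \<subseteq> pinj_maps" using map_option_pinj by blast
  then have "?P closure_of ?S \<subseteq> pinj_maps"
    by (simp add: closure_of_minimal closedin_pinj_maps)
  moreover have "pinj_maps \<subseteq> ?P closure_of ?S"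
    using closure_of_subtopology_subset[of ?P pinj_maps ?S]
    unfolding pinj_closure_of_permutations[OF assms] .
  ultimately have "?P closure_of ?S = pinj_maps" by (rule subset_antisym)
  then show ?thesis by (simp add: env_top_def restrict_def)
qed


section \<open>The Roelcke compactification\<close>

lemma dbl_fixator_agree:
  assumes "b \<in> dbl (\<circ>) (fixator F) g"
  shows "bij g \<Longrightarrow> bij b" "agree F (map_option g) (map_option b)"
  using assms agree_double_coset[of _ F _ g]
  by (auto simp: dbl_def fixator_def intro!: bij_comp)

lemma agree_in_dbl:
  assumes "finite F" "fixator F \<subseteq> U" "bij g" "bij b" "agree F (map_option g) (map_option b)"
  shows "b \<in> dbl (\<circ>) U g"
proof -
  obtain a c where "a \<in> fixator F" "c \<in> fixator F" "b = a \<circ> g \<circ> c"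
    using double_coset_if_agree[OF assms(1,3,4,5)] by blast
  then show ?thesis unfolding dbl_def using assms(2) by blast
qed

lemma embedding_map_option: "embedding_map (perm_top :: ('a \<Rightarrow> 'a) topology) pinj_top map_option"
proof -
  let ?G = "perm_top :: ('a \<Rightarrow> 'a) topology"
  have inj: "inj_on map_option (topspace (perm_top :: ('a \<Rightarrow> 'a) topology))"
  proof (rule inj_onI, rule ext)
    fix g h :: "'a \<Rightarrow> 'a" and x assume "map_option g = map_option h"
    then have "map_option g (Some x) = map_option h (Some x)" by (rule fun_cong)
    then show "g x = h x" by simp
  qed
  have cont: "continuous_map (perm_top :: ('a \<Rightarrow> 'a) topology) pinj_top map_option"
  proof (rule continuous_map_into_pinj_top)
    fix x y :: 'a
    have eq: "{g \<in> topspace perm_top. map_option g (Some x) = Some y} = {g. bij g \<and> g x = y}" by simp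
    show "openin perm_top {g \<in> topspace perm_top. map_option g (Some x) = Some y}"
      unfolding eq by (rule openin_perm_top_value)
    have "topspace perm_top - {g. bij g \<and> g x = y} = (\<Union>v\<in>-{y}. {g. bij g \<and> g x = v})" by auto
    moreover have "openin perm_top \<dots>"
      by (rule openin_Union) (auto intro: openin_perm_top_value)
    ultimately show "closedin perm_top {g \<in> topspace perm_top. map_option g (Some x) = Some y}"
      unfolding eq closedin_def by auto
  qed (simp add: map_option_pinj)
  have op: "openin (subtopology pinj_top (map_option ` topspace perm_top)) (map_option ` U)"
    if U: "openin perm_top U" for U :: "('a \<Rightarrow> 'a) set"
  proof -
    \<comment> \<open>The union of all open sets whose trace lies in the image of \<open>U\<close>;
      it remains to cover that image pointwise.\<close>
    let ?V = "\<Union>{V. openin pinj_top V \<and> V \<inter> map_option ` {g. bij g} \<subseteq> map_option ` U}"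
    have VO: "openin pinj_top ?V" by (rule openin_Union) blast
    have VE: "map_option ` U = ?V \<inter> map_option ` {g. bij g}"
    proof (rule subset_antisym; rule subsetI)
      fix f assume "f \<in> map_option ` U"
      then obtain g where g: "g \<in> U" "f = map_option g" by blast
      then obtain F where F: "finite F" "{g'. bij g' \<and> (\<forall>x\<in>F. g' x = g x)} \<subseteq> U" and "bij g"
        using U unfolding openin_perm_top by blast
      \<comment> \<open>\<open>F\<close> alone would not show the values of \<open>g\<close> outside
        \<open>F\<close>; adding the images makes agreement force equality on
        \<open>F\<close>.\<close>
      let ?V' = "{f \<in> pinj_maps. agree (F \<union> g ` F) (map_option g) f}"
      have "openin pinj_top ?V'" using F(1) by (intro openin_agree) simp
      moreover have "?V' \<inter> map_option ` {g. bij g} \<subseteq> map_option ` U"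
      proof
        fix k assume "k \<in> ?V' \<inter> map_option ` {g. bij g}"
        then obtain g' where g': "k = map_option g'" "bij g'" "agree (F \<union> g ` F) (map_option g) (map_option g')" by blast
        then have "\<forall>x\<in>F. g' x = g x" by (auto simp: agree_map_option)
        then show "k \<in> map_option ` U" using F(2) g'(1,2) by blast
      qed
      moreover have "f \<in> ?V'" using g(2) \<open>bij g\<close> agree_refl by (simp add: map_option_pinj)
      ultimately show "f \<in> ?V \<inter> map_option ` {g. bij g}" using g \<open>bij g\<close> by blast
    qed blast
    show ?thesis
      using openin_subtopology_Int[OF VO, of "map_option ` {g. bij g}"] unfolding VE[symmetric] by simp
  qed
  have im: "map_option ` topspace (perm_top :: ('a \<Rightarrow> 'a) topology) \<subseteq> pinj_maps" using map_option_pinj by auto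
  have "homeomorphic_map (perm_top :: ('a \<Rightarrow> 'a) topology) (subtopology pinj_top (map_option ` topspace perm_top)) map_option"
  proof (rule bijective_open_imp_homeomorphic_map)
    show "continuous_map ?G (subtopology pinj_top (map_option ` topspace ?G)) map_option"
      using cont by (simp add: continuous_map_in_subtopology)
    show "open_map ?G (subtopology pinj_top (map_option ` topspace ?G)) map_option"
      using op by (simp add: open_map_def)
    show "map_option ` topspace ?G = topspace (subtopology pinj_top (map_option ` topspace ?G))"
      using im by auto
  qed (rule inj)
  then show ?thesis unfolding embedding_map_def .
qed

lemma compactification_pinj_top:
  assumes "infinite (UNIV :: 'a set)"
  shows "compactification (perm_top :: ('a \<Rightarrow> 'a) topology) pinj_top map_option"
  unfolding compactification_def
  using compact_space_pinj_top Hausdorff_space_pinj_top embedding_map_option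
    pinj_closure_of_permutations[OF assms] by simp

text \<open>A Lebesgue number argument: finitely many classes whose squares lie in \<open>W\<close>
  cover the space. As \<open>agree\<close> is an equivalence relation, the union of the
  corresponding finite sets serves directly, without halving entourages.\<close>

lemma entourage_contains_agree:
  assumes W: "openin (prod_topology pinj_top pinj_top) W" "\<And>z. z \<in> pinj_maps \<Longrightarrow> (z, z) \<in> W"
  obtains F where "finite F" "\<And>f g. f \<in> pinj_maps \<Longrightarrow> g \<in> pinj_maps \<Longrightarrow> agree F f g \<Longrightarrow> (f, g) \<in> W"
proof -
  have "\<exists>F. finite F \<and> {f \<in> pinj_maps. agree F z f} \<times> {f \<in> pinj_maps. agree F z f} \<subseteq> W" if z: "z \<in> pinj_maps" for z
  proof -
    obtain U V where UV: "openin pinj_top U" "openin pinj_top V" "z \<in> U" "z \<in> V" "U \<times> V \<subseteq> W"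
      using W(1)[unfolded openin_prod_topology_alt, rule_format, OF W(2)[OF z]] by (elim exE conjE)
    then have "openin pinj_top (U \<inter> V)" "z \<in> U \<inter> V" by auto
    then obtain F where "finite F" "{f \<in> pinj_maps. agree F z f} \<subseteq> U \<inter> V"
      unfolding openin_pinj_top by blast
    then show ?thesis using UV(5) by (intro exI[of _ F]) auto
  qed
  then have "\<forall>z\<in>pinj_maps. \<exists>F. finite F \<and> {f \<in> pinj_maps. agree F z f} \<times> {f \<in> pinj_maps. agree F z f} \<subseteq> W"
    by (rule ballI)
  from bchoice[OF this] obtain F where F': "\<forall>z\<in>pinj_maps. finite (F z) \<and>
      {f \<in> pinj_maps. agree (F z) z f} \<times> {f \<in> pinj_maps. agree (F z) z f} \<subseteq> W"
    by (elim exE)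
  note F = F'[rule_format, THEN conjunct1] F'[rule_format, THEN conjunct2]
  let ?N = "\<lambda>z. {f \<in> pinj_maps. agree (F z) z f}"
  have "pinj_maps \<subseteq> \<Union>(?N ` pinj_maps)" using agree_refl by blast
  moreover have "compactin pinj_top pinj_maps"
    using compact_space_pinj_top by (simp add: compact_space_def)
  moreover have "\<forall>U \<in> ?N ` pinj_maps. openin pinj_top U" using F(1) openin_agree by blast
  ultimately obtain \<F> where \<F>: "finite \<F>" "\<F> \<subseteq> ?N ` pinj_maps" "pinj_maps \<subseteq> \<Union>\<F>"
    using compactinD[of pinj_top pinj_maps "?N ` pinj_maps"] by auto
  then obtain Z where Z: "finite Z" "Z \<subseteq> pinj_maps" "\<F> = ?N ` Z"
    using finite_subset_image[OF \<F>(1,2)] by blast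
  show thesis
  proof (rule that[of "\<Union>(F ` Z)"])
    show "finite (\<Union>(F ` Z))" using Z F(1) by (intro finite_UN_I) auto
    fix f g :: "'a option \<Rightarrow> 'a option"
    assume fg: "f \<in> pinj_maps" "g \<in> pinj_maps" "agree (\<Union>(F ` Z)) f g"
    obtain z where z: "z \<in> Z" "agree (F z) z f" using \<F>(3) Z(3) fg(1) by blast
    have "agree (F z) f g" using z(1) by (intro agree_mono[OF fg(3)]) blast
    then have "agree (F z) z g" by (rule agree_trans[OF z(2)])
    then show "(f, g) \<in> W" using F(2)[of z] z Z(2) fg by blast
  qed
qed

lemma roelcke_compactification_pinj_top:
  assumes "infinite (UNIV :: 'a set)"
  shows "roelcke_compactification (perm_top :: ('a \<Rightarrow> 'a) topology) (\<circ>) id pinj_top map_option"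
  unfolding roelcke_compactification_def
proof (intro conjI allI impI)
  show "compactification (perm_top :: ('a \<Rightarrow> 'a) topology) pinj_top map_option"
    by (rule compactification_pinj_top[OF assms])
next
  fix W :: "(('a option \<Rightarrow> 'a option) \<times> ('a option \<Rightarrow> 'a option)) set"
  assume "openin (prod_topology pinj_top pinj_top) W \<and> (\<forall>z\<in>topspace pinj_top. (z, z) \<in> W)"
  then obtain F where F: "finite F" "\<And>f g. f \<in> pinj_maps \<Longrightarrow> g \<in> pinj_maps \<Longrightarrow> agree F f g \<Longrightarrow> (f, g) \<in> W"
    using entourage_contains_agree[of W] unfolding topspace_pinj_top by blast
  show "\<exists>U. openin perm_top U \<and> id \<in> U \<and>
      (\<forall>g\<in>topspace perm_top. \<forall>a\<in>dbl (\<circ>) U g. \<forall>b\<in>dbl (\<circ>) U g. (map_option a, map_option b) \<in> W)"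
  proof (intro exI[of _ "fixator F"] conjI ballI)
    fix g a b :: "'a \<Rightarrow> 'a"
    assume g: "g \<in> topspace perm_top" and ab: "a \<in> dbl (\<circ>) (fixator F) g" "b \<in> dbl (\<circ>) (fixator F) g"
    have "bij g" using g by simp
    then show "(map_option a, map_option b) \<in> W"
      using dbl_fixator_agree[OF ab(1)] dbl_fixator_agree[OF ab(2)]
      by (intro F(2) map_option_pinj) (auto intro: agree_trans agree_sym)
  qed (use F(1) openin_perm_top_fixator id_in_fixator in auto)
next
  fix U :: "('a \<Rightarrow> 'a) set" assume "openin perm_top U \<and> id \<in> U"
  then obtain F where F: "finite F" "fixator F \<subseteq> U" using fixator_subset_if_openin by blast
  let ?W = "{(f, g). f \<in> pinj_maps \<and> g \<in> pinj_maps \<and> agree F f g}"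
  show "\<exists>W. openin (prod_topology pinj_top pinj_top) W \<and> (\<forall>z\<in>topspace pinj_top. (z, z) \<in> W) \<and>
      (\<forall>a\<in>topspace perm_top. \<forall>b\<in>topspace perm_top. (map_option a, map_option b) \<in> W \<longrightarrow>
        (\<exists>g\<in>topspace perm_top. a \<in> dbl (\<circ>) U g \<and> b \<in> dbl (\<circ>) U g))"
  proof (intro exI[of _ ?W] conjI ballI impI)
    \<comment> \<open>Around each of its pairs, the relation contains the square of an open
      class.\<close>
    show "openin (prod_topology pinj_top pinj_top) ?W"
      unfolding openin_prod_topology_alt
    proof (intro allI impI)
      fix f g assume "(f, g) \<in> ?W"
      then have fg: "f \<in> pinj_maps" "g \<in> pinj_maps" "agree F f g" by auto
      let ?N = "{k \<in> pinj_maps. agree F f k}"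
      have "?N \<times> ?N \<subseteq> ?W" by (auto intro: agree_trans agree_sym)
      then show "\<exists>U V. openin pinj_top U \<and> openin pinj_top V \<and> f \<in> U \<and> g \<in> V \<and> U \<times> V \<subseteq> ?W"
        using fg agree_refl[of F f] openin_agree[OF F(1), of f]
        by (intro exI[of _ ?N]) simp
    qed
    show "(z, z) \<in> ?W" if "z \<in> topspace pinj_top" for z
      using that agree_refl unfolding topspace_pinj_top by blast
    fix a b :: "'a \<Rightarrow> 'a"
    assume ab: "a \<in> topspace perm_top" "b \<in> topspace perm_top" "(map_option a, map_option b) \<in> ?W"
    then show "\<exists>g\<in>topspace perm_top. a \<in> dbl (\<circ>) U g \<and> b \<in> dbl (\<circ>) U g"
      using agree_in_dbl[OF F, of a] agree_refl by (intro bexI[of _ a]) auto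
  qed
qed

text \<open>The double coset of \<open>g\<close> is determined by the part of its graph in
  \<open>F\<close> x \<open>F\<close>, for which there are finitely many possibilities;
  \<open>R\<close> represents all those that occur.\<close>

lemma roelcke_precompact_perm_top: "roelcke_precompact (perm_top :: ('a \<Rightarrow> 'a) topology) (\<circ>) id"
  unfolding roelcke_precompact_def
proof (intro allI impI)
  fix U :: "('a \<Rightarrow> 'a) set" assume U: "openin perm_top U \<and> id \<in> U"
  then obtain F where F: "finite F" "fixator F \<subseteq> U" using fixator_subset_if_openin by blast
  have Ubij: "\<And>u. u \<in> U \<Longrightarrow> bij u" using U unfolding openin_perm_top by blast
  define pat where "pat g = {(x, y) \<in> F \<times> F. g x = y}" for g :: "'a \<Rightarrow> 'a"
  have pat: "pat g = pat h \<Longrightarrow> agree F (map_option g) (map_option h)" for g h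
    by (auto simp: pat_def agree_map_option)
  have "pat ` {g. bij g} \<subseteq> Pow (F \<times> F)" by (auto simp: pat_def)
  then have "finite (pat ` {g. bij g})" using F(1) by (meson finite_Pow_iff finite_SigmaI finite_subset)
  then obtain R where R: "R \<subseteq> {g. bij g}" "finite R" "pat ` {g. bij g} = pat ` R"
    by (metis finite_subset_image subset_refl)
  show "\<exists>F. finite F \<and> F \<subseteq> topspace perm_top \<and> topspace perm_top = \<Union> (dbl (\<circ>) U ` F)"
  proof (intro exI[of _ R] conjI subset_antisym subsetI)
    fix g :: "'a \<Rightarrow> 'a" assume "g \<in> topspace perm_top"
    then have g: "bij g" by simp
    then have "pat g \<in> pat ` R" using R(3) by blast
    then obtain r where r: "r \<in> R" "pat g = pat r" by (elim imageE)
    then have "g \<in> dbl (\<circ>) U r"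
      using R(1) g by (intro agree_in_dbl[OF F]) (auto intro: pat)
    then show "g \<in> \<Union> (dbl (\<circ>) U ` R)" using r(1) by blast
  next
    fix g assume "g \<in> \<Union> (dbl (\<circ>) U ` R)"
    then show "g \<in> topspace perm_top"
      using R(1) Ubij by (auto simp: dbl_def intro!: bij_comp)
  qed (use R in auto)
qed

section \<open>The semigroup structure\<close>

lemma pinj_comp:
  assumes "f \<in> pinj_maps" "g \<in> pinj_maps"
  shows "f \<circ> g \<in> pinj_maps"
  unfolding pinj_maps_iff
proof (intro conjI allI impI)
  show "(f \<circ> g) None = None" by (simp add: pinj_None assms)
  fix x x' y assume eq: "(f \<circ> g) (Some x) = Some y \<and> (f \<circ> g) (Some x') = Some y"
  obtain u u' where "g (Some x) = Some u" "g (Some x') = Some u'"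
    using eq pinj_None[OF assms(1)] by (cases "g (Some x)"; cases "g (Some x')") auto
  then show "x = x'" using eq pinj_inj[OF assms(1), of u y u'] pinj_inj[OF assms(2), of x u x'] by simp
qed

text \<open>The test \<open>w \<noteq> None\<close> keeps the points where \<open>f\<close> is
  infinite from becoming preimages of \<open>None\<close>; on \<open>pinj_maps\<close> the choice by
  \<open>SOME\<close> is unique.\<close>

definition pinj_inverse :: "('a option \<Rightarrow> 'a option) \<Rightarrow> 'a option \<Rightarrow> 'a option" where
  "pinj_inverse f w = (if \<exists>x. w \<noteq> None \<and> f (Some x) = w then Some (SOME x. f (Some x) = w) else None)"

lemma pinj_inverse_eq_Some:
  assumes "f \<in> pinj_maps"
  shows "pinj_inverse f (Some y) = Some x \<longleftrightarrow> f (Some x) = Some y"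
proof
  assume "pinj_inverse f (Some y) = Some x"
  then show "f (Some x) = Some y"
    unfolding pinj_inverse_def by (auto split: if_splits intro: someI)
next
  assume x: "f (Some x) = Some y"
  have "(SOME x. f (Some x) = Some y) = x"
    using pinj_inj[OF assms _ x] x by (intro some_equality)
  then show "pinj_inverse f (Some y) = Some x" using x by (auto simp: pinj_inverse_def)
qed

lemma pinj_inverse_None: "pinj_inverse f None = None"
  by (simp add: pinj_inverse_def)

lemma pinj_inverse_pinj:
  assumes "f \<in> pinj_maps"
  shows "pinj_inverse f \<in> pinj_maps"
  unfolding pinj_maps_iff
  by (auto simp: pinj_inverse_None pinj_inverse_eq_Some[OF assms])

lemma option_fun_eqI:
  assumes "f None = g None" "\<And>x y. f (Some x) = Some y \<longleftrightarrow> g (Some x) = Some y"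
  shows "f = g"
proof
  fix w
  show "f w = g w"
  proof (cases w)
    case (Some x)
    show ?thesis
    proof (cases "f w")
      case None
      then show ?thesis using assms(2)[of x] Some by (cases "g w") auto
    next
      case (Some y)
      then show ?thesis using assms(2)[of x y] \<open>w = Some x\<close> by simp
    qed
  qed (simp add: assms)
qed

text \<open>By injectivity, \<open>s t s = s\<close> makes \<open>t\<close> send each finite value
  of \<open>s\<close> back to its only preimage; the same argument for \<open>t s t = t\<close>
  shows that \<open>t\<close> is finite nowhere else.\<close>

lemma is_inverse_of_pinj_iff:
  assumes s: "s \<in> pinj_maps"
  shows "is_inverse_of (\<circ>) pinj_maps s t \<longleftrightarrow> t = pinj_inverse s"
proof
  assume "is_inverse_of (\<circ>) pinj_maps s t"
  then have t: "t \<in> pinj_maps" and sts: "\<And>w. s (t (s w)) = s w" and tst: "\<And>w. t (s (t w)) = t w"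
    unfolding is_inverse_of_def by (auto simp: fun_eq_iff)
  have *: "b (Some y) = Some x" if "a (Some x) = Some y" and a: "a \<in> pinj_maps" and aba: "\<And>w. a (b (a w)) = a w" for a b :: "'a option \<Rightarrow> 'a option" and x y
  proof -
    have e: "a (b (Some y)) = Some y" using aba[of "Some x"] that(1) by simp
    then obtain x' where x': "b (Some y) = Some x'" using pinj_None[OF a] by (cases "b (Some y)") auto
    then show ?thesis using e pinj_inj[OF a, of x' y x] that(1) by simp
  qed
  show "t = pinj_inverse s"
  proof (rule option_fun_eqI)
    show "t None = pinj_inverse s None" by (simp add: pinj_None[OF t] pinj_inverse_None)
    fix y x
    show "t (Some y) = Some x \<longleftrightarrow> pinj_inverse s (Some y) = Some x"
      unfolding pinj_inverse_eq_Some[OF s] using *[OF _ s sts] *[OF _ t tst] by blast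
  qed
next
  assume t: "t = pinj_inverse s"
  have *: "a \<circ> b \<circ> a = a"
    if a: "a \<in> pinj_maps" and b: "b \<in> pinj_maps" and ab: "\<And>x y. a (Some x) = Some y \<Longrightarrow> b (Some y) = Some x"
    for a b :: "'a option \<Rightarrow> 'a option"
  proof
    fix w
    show "(a \<circ> b \<circ> a) w = a w"
    proof (cases "a w")
      case None
      then show ?thesis by (simp add: pinj_None[OF a] pinj_None[OF b])
    next
      case (Some y)
      then obtain x where "w = Some x" using pinj_None[OF a] by (cases w) auto
      then show ?thesis using ab[of x y] Some by simp
    qed
  qed
  show "is_inverse_of (\<circ>) pinj_maps s t"
    unfolding is_inverse_of_def t using pinj_inverse_pinj[OF s] s
    by (auto intro!: * simp: pinj_inverse_eq_Some)
qed

text \<open>A condition \<open>(a o f) (Some x) = Some y\<close> on \<open>f\<close> is either never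
  met or equivalent to one condition \<open>f w = Some v\<close>, since \<open>a\<close> attains
  \<open>Some y\<close> at most once. Injectivity is thus what makes left multiplication
  continuous.\<close>

lemma continuous_map_pinj_comp:
  assumes a: "a \<in> pinj_maps"
  shows "continuous_map pinj_top pinj_top ((\<circ>) a)" "continuous_map pinj_top pinj_top (\<lambda>f. f \<circ> a)"
proof -
  have clopen: "openin pinj_top {f \<in> pinj_maps. P f} \<and> closedin pinj_top {f \<in> pinj_maps. P f}"
    if "(\<forall>f\<in>pinj_maps. \<not> P f) \<or> (\<exists>w y. \<forall>f\<in>pinj_maps. P f \<longleftrightarrow> f w = Some y)" for P :: "('a option \<Rightarrow> 'a option) \<Rightarrow> bool"
    using that
  proof
    assume "\<forall>f\<in>pinj_maps. \<not> P f"
    then have "{f \<in> pinj_maps. P f} = {}" by blast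
    then show ?thesis by (simp only: openin_empty closedin_empty simp_thms)
  next
    assume "\<exists>w y. \<forall>f\<in>pinj_maps. P f \<longleftrightarrow> f w = Some y"
    then obtain w y where "{f \<in> pinj_maps. P f} = {f \<in> pinj_maps. f w = Some y}" by blast
    then show ?thesis by (simp only: clopen_pinj_value simp_thms)
  qed
  show "continuous_map pinj_top pinj_top ((\<circ>) a)"
  proof (rule continuous_map_into_pinj_top)
    show "a \<circ> f \<in> pinj_maps" if "f \<in> topspace pinj_top" for f
      using that a pinj_comp unfolding topspace_pinj_top by blast
    fix x y :: 'a
    have "(\<forall>f\<in>pinj_maps. (a \<circ> f) (Some x) \<noteq> Some y) \<or>
        (\<exists>w v. \<forall>f\<in>pinj_maps. (a \<circ> f) (Some x) = Some y \<longleftrightarrow> f w = Some v)"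
    proof (cases "\<exists>v. a (Some v) = Some y")
      case True
      then obtain v where v: "a (Some v) = Some y" by blast
      have "a w = Some y \<longleftrightarrow> w = Some v" for w
      proof (cases w)
        case (Some u)
        have "a (Some u) = Some y \<longleftrightarrow> u = v" using v pinj_inj[OF a _ v, of u] by blast
        then show ?thesis using Some by simp
      qed (simp add: pinj_None[OF a])
      then have "(a \<circ> f) (Some x) = Some y \<longleftrightarrow> f (Some x) = Some v" for f by simp
      then show ?thesis by blast
    next
      case False
      have "(a \<circ> f) (Some x) \<noteq> Some y" for f
        using False pinj_None[OF a] by (cases "f (Some x)") auto
      then show ?thesis by blast
    qed
    from clopen[OF this]
    show "openin pinj_top {f \<in> topspace pinj_top. (a \<circ> f) (Some x) = Some y}"
      "closedin pinj_top {f \<in> topspace pinj_top. (a \<circ> f) (Some x) = Some y}"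
      unfolding topspace_pinj_top by auto
  qed
  show "continuous_map pinj_top pinj_top (\<lambda>f. f \<circ> a)"
  proof (rule continuous_map_into_pinj_top)
    show "f \<circ> a \<in> pinj_maps" if "f \<in> topspace pinj_top" for f
      using that a pinj_comp unfolding topspace_pinj_top by blast
    fix x y :: 'a
    have "(\<forall>f\<in>pinj_maps. (f \<circ> a) (Some x) \<noteq> Some y) \<or>
        (\<exists>w v. \<forall>f\<in>pinj_maps. (f \<circ> a) (Some x) = Some y \<longleftrightarrow> f w = Some v)"
      unfolding comp_apply by blast
    from clopen[OF this]
    show "openin pinj_top {f \<in> topspace pinj_top. (f \<circ> a) (Some x) = Some y}"
      "closedin pinj_top {f \<in> topspace pinj_top. (f \<circ> a) (Some x) = Some y}"
      unfolding topspace_pinj_top by auto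
  qed
qed

text \<open>Serves the actions on \<open>alphaX\<close> and on partial injections, with
  \<open>c\<close> the identity or the evaluation at a point. Every permutation attains
  \<open>y\<close> at exactly one \<open>v\<close>, so the complement too is a union of open
  boxes.\<close>

lemma clopen_perm_action:
  assumes ope: "\<And>y. openin T {w \<in> topspace T. c w = Some y}"
    and clo: "\<And>y. closedin T {w \<in> topspace T. c w = Some y}"
  shows "openin (prod_topology perm_top T) {p \<in> topspace (prod_topology perm_top T). map_option (fst p) (c (snd p)) = Some y}"
    and "closedin (prod_topology perm_top T) {p \<in> topspace (prod_topology perm_top T). map_option (fst p) (c (snd p)) = Some y}"
proof -
  let ?A = "{p \<in> topspace (prod_topology perm_top T). map_option (fst p) (c (snd p)) = Some y}"
  have A: "?A = (\<Union>v. {g. bij g \<and> g v = y} \<times> {w \<in> topspace T. c w = Some v})"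
    by auto
  show "openin (prod_topology perm_top T) ?A"
    unfolding A by (rule openin_Union) (auto intro!: openin_prod_Times_iff[THEN iffD2] openin_perm_top_value ope)
  have B: "topspace (prod_topology perm_top T) - ?A =
      (\<Union>v. {g. bij g \<and> g v = y} \<times> (topspace T - {w \<in> topspace T. c w = Some v}))" (is "?L = ?R")
  proof (rule subset_antisym; rule subsetI)
    fix p assume p: "p \<in> ?L"
    then have "bij (fst p)" by auto
    then obtain v where "fst p v = y" by (metis bij_pointE)
    then show "p \<in> ?R" using p by (cases p) auto
  next
    fix p assume "p \<in> ?R"
    then obtain g w v where p: "p = (g, w)" "bij g" "g v = y" "w \<in> topspace T" "c w \<noteq> Some v" by blast
    then have "map_option g (c w) \<noteq> Some y" by (auto dest: bij_is_inj injD)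
    then show "p \<in> ?L" using p by auto
  qed
  have "openin (prod_topology perm_top T) ?R"
    by (rule openin_Union) (auto intro!: openin_prod_Times_iff[THEN iffD2] openin_perm_top_value openin_diff clo)
  then show "closedin (prod_topology perm_top T) ?A"
    unfolding closedin_def B[symmetric] by blast
qed

lemma sim_compactification_pinj_top:
  assumes "infinite (UNIV :: 'a set)"
  shows "sim_compactification (perm_top :: ('a \<Rightarrow> 'a) topology) (\<circ>) pinj_top map_option (\<circ>)"
  unfolding sim_compactification_def sm_compactification_def topspace_pinj_top
proof (intro conjI ballI)
  show "compactification (perm_top :: ('a \<Rightarrow> 'a) topology) pinj_top map_option"
    by (rule compactification_pinj_top[OF assms])
  show "x \<circ> y \<in> pinj_maps" if "x \<in> pinj_maps" "y \<in> pinj_maps" for x y :: "'a option \<Rightarrow> 'a option"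
    using that by (rule pinj_comp)
  show "x \<circ> y \<circ> z = x \<circ> (y \<circ> z)" for x y z :: "'a option \<Rightarrow> 'a option"
    by (rule comp_assoc)
  show "\<exists>u\<in>pinj_maps. \<forall>x\<in>pinj_maps. u \<circ> x = x \<and> x \<circ> u = (x :: 'a option \<Rightarrow> 'a option)"
    by (intro bexI[of _ id]) (auto simp: pinj_maps_iff)
  show "continuous_map pinj_top pinj_top ((\<circ>) a)" "continuous_map pinj_top pinj_top (\<lambda>x. x \<circ> a)"
    if "a \<in> pinj_maps" for a :: "'a option \<Rightarrow> 'a option"
    by (rule continuous_map_pinj_comp[OF that])+
  show "continuous_map (prod_topology perm_top pinj_top) pinj_top
      (\<lambda>(g :: 'a \<Rightarrow> 'a, y). map_option g \<circ> y)"
  proof (rule continuous_map_into_pinj_top)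
    fix p :: "('a \<Rightarrow> 'a) \<times> ('a option \<Rightarrow> 'a option)"
    assume "p \<in> topspace (prod_topology perm_top pinj_top)"
    then have "bij (fst p)" "snd p \<in> pinj_maps" by auto
    then show "(case p of (g, y) \<Rightarrow> map_option g \<circ> y) \<in> pinj_maps"
      by (simp add: split_beta pinj_comp map_option_pinj)
  next
    fix x y :: 'a
    have eq: "(case p of (g, f) \<Rightarrow> map_option g \<circ> f) (Some x) = map_option (fst p) ((\<lambda>f. f (Some x)) (snd p))" for p
      by (simp add: split_beta)
    have *: "openin pinj_top {f \<in> topspace pinj_top. f (Some x) = Some y}"
       "closedin pinj_top {f \<in> topspace pinj_top. f (Some x) = Some y}" for y
      unfolding topspace_pinj_top by (rule clopen_pinj_value)+
    show "openin (prod_topology perm_top pinj_top) {s \<in> topspace (prod_topology perm_top pinj_top).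
         (case s of (g :: 'a \<Rightarrow> 'a, f) \<Rightarrow> map_option g \<circ> f) (Some x) = Some y}"
      "closedin (prod_topology perm_top pinj_top) {s \<in> topspace (prod_topology perm_top pinj_top).
         (case s of (g :: 'a \<Rightarrow> 'a, f) \<Rightarrow> map_option g \<circ> f) (Some x) = Some y}"
      unfolding eq by (rule clopen_perm_action[OF *])+
  qed
  show "map_option g \<circ> map_option h = map_option (g \<circ> h)" for g h :: "'a \<Rightarrow> 'a"
    by (simp add: fun_eq_iff option.map_comp)
  show "\<exists>!t. is_inverse_of (\<circ>) pinj_maps s t" if "s \<in> pinj_maps" for s :: "'a option \<Rightarrow> 'a option"
    unfolding is_inverse_of_pinj_iff[OF that] by simp
  have inv: "(THE t. is_inverse_of (\<circ>) pinj_maps s t) = pinj_inverse s" if "s \<in> pinj_maps" for s :: "'a option \<Rightarrow> 'a option"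
    unfolding is_inverse_of_pinj_iff[OF that] by simp
  have "continuous_map pinj_top pinj_top (pinj_inverse :: ('a option \<Rightarrow> 'a option) \<Rightarrow> _)"
  proof (rule continuous_map_into_pinj_top)
    show "pinj_inverse s \<in> pinj_maps" if "s \<in> topspace pinj_top" for s :: "'a option \<Rightarrow> 'a option"
      using that unfolding topspace_pinj_top by (rule pinj_inverse_pinj)
    fix x y :: 'a
    have eq: "{s \<in> topspace pinj_top. pinj_inverse s (Some x) = Some y} = {s \<in> pinj_maps. s (Some y) = Some x}"
      unfolding topspace_pinj_top by (intro Collect_cong conj_cong refl pinj_inverse_eq_Some)
    show "openin pinj_top {s \<in> topspace pinj_top. pinj_inverse s (Some x) = Some y}"
      "closedin pinj_top {s \<in> topspace pinj_top. pinj_inverse s (Some x) = Some y}"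
      unfolding eq by (rule clopen_pinj_value)+
  qed
  then show "continuous_map pinj_top pinj_top (\<lambda>s :: 'a option \<Rightarrow> 'a option. THE t. is_inverse_of (\<circ>) pinj_maps s t)"
    by (rule continuous_map_eq) (simp only: topspace_pinj_top inv)
qed

text \<open>\<open>None\<close> plays the part of "undefined": fixing it turns ordinary composition
  into composition of partial maps, and strict extension by \<open>Option.bind\<close> inverts the
  restriction.\<close>

lemma monoid_iso_pinj_maps:
  "monoid_iso_to_IX (pinj_maps :: ('a option \<Rightarrow> 'a option) set) (\<circ>) UNIV (\<lambda>f. f \<circ> Some)"
  unfolding monoid_iso_to_IX_def
proof (intro conjI ballI)
  show "bij_betw (\<lambda>f. f \<circ> Some) (pinj_maps :: ('a option \<Rightarrow> 'a option) set) (sym_inverse_semigroup UNIV)"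
  proof (rule bij_betw_byWitness[where f' = "\<lambda>k w. Option.bind w k"])
    show "\<forall>f\<in>pinj_maps. (\<lambda>w. Option.bind w (f \<circ> Some)) = (f :: 'a option \<Rightarrow> 'a option)"
    proof (intro ballI ext)
      fix f :: "'a option \<Rightarrow> 'a option" and w assume "f \<in> pinj_maps"
      then show "Option.bind w (f \<circ> Some) = f w" by (cases w) (simp_all add: pinj_None)
    qed
    show "\<forall>k\<in>sym_inverse_semigroup UNIV. (\<lambda>w. Option.bind w k) \<circ> Some = (k :: 'a \<rightharpoonup> 'a)"
      by (simp add: fun_eq_iff)
    show "(\<lambda>f. f \<circ> Some) ` pinj_maps \<subseteq> sym_inverse_semigroup (UNIV :: 'a set)"
    proof (rule image_subsetI)
      fix f :: "'a option \<Rightarrow> 'a option" assume f: "f \<in> pinj_maps"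
      have "inj_on (f \<circ> Some) (dom (f \<circ> Some))"
        by (rule inj_onI) (use pinj_inj[OF f] in auto)
      then show "f \<circ> Some \<in> sym_inverse_semigroup UNIV" by (simp add: sym_inverse_semigroup_def)
    qed
    show "(\<lambda>k w. Option.bind w k) ` sym_inverse_semigroup (UNIV :: 'a set) \<subseteq> pinj_maps"
    proof (rule image_subsetI)
      fix k :: "'a \<rightharpoonup> 'a" assume "k \<in> sym_inverse_semigroup UNIV"
      then have inj: "inj_on k (dom k)" by (simp add: sym_inverse_semigroup_def)
      have "x = x'" if "k x = Some y" "k x' = Some y" for x x' y
        using inj_onD[OF inj, of x x'] that by auto
      then show "(\<lambda>w. Option.bind w k) \<in> pinj_maps" by (simp add: pinj_maps_iff)
    qed
  qed
  show "(s \<circ> t) \<circ> Some = (s \<circ> Some) \<circ>\<^sub>m (t \<circ> Some)" if "s \<in> pinj_maps" for s t :: "'a option \<Rightarrow> 'a option"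
    by (rule ext) (simp add: map_comp_def pinj_None[OF that] split: option.split)
qed


section \<open>Compactifications of the discrete space\<close>

lemma G_compactification_alphaX:
  assumes "infinite (UNIV :: 'a set)"
  shows "G_compactification (perm_top :: ('a \<Rightarrow> 'a) topology) (\<lambda>g x. g x) (discrete_topology UNIV)
        alphaX Some (\<lambda>g. map_option g)"
  unfolding G_compactification_def compactification_def
proof (intro conjI ballI)
  show "embedding_map (discrete_topology UNIV) (alphaX :: 'a option topology) Some"
    unfolding alexandroff_eq_Alexandroff_compactification by (rule embedding_map_Some)
  \<comment> \<open>The discrete space is dense because it is not compact, that is,
    infinite.\<close>
  show "alphaX closure_of (Some ` topspace (discrete_topology UNIV)) = topspace (alphaX :: 'a option topology)"
    unfolding alexandroff_eq_Alexandroff_compactification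
    by (rule Alexandroff_compactification_dense) (simp add: compact_space_discrete_topology assms)
  show "continuous_map (prod_topology perm_top alphaX) alphaX (\<lambda>(g :: 'a \<Rightarrow> 'a, y). map_option g y)"
  proof (rule continuous_map_into_alphaX)
    fix y :: 'a
    have eq: "(case p of (g, w) \<Rightarrow> map_option g w) = map_option (fst p) ((\<lambda>w. w) (snd p))"
      for p :: "('a \<Rightarrow> 'a) \<times> 'a option"
      by (simp add: split_beta)
    have *: "openin alphaX {w \<in> topspace alphaX. w = Some y}" "closedin alphaX {w \<in> topspace alphaX. w = Some y}" for y :: 'a
      using openin_alphaX_Some[of y] closedin_alphaX_Some[of y] by simp_all
    show "openin (prod_topology perm_top alphaX) {s \<in> topspace (prod_topology perm_top alphaX).
         (case s of (g :: 'a \<Rightarrow> 'a, w) \<Rightarrow> map_option g w) = Some y}"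
      "closedin (prod_topology perm_top alphaX) {s \<in> topspace (prod_topology perm_top alphaX).
         (case s of (g :: 'a \<Rightarrow> 'a, w) \<Rightarrow> map_option g w) = Some y}"
      unfolding eq by (rule clopen_perm_action[OF *])+
  qed
qed (simp_all add: compact_space_alphaX Hausdorff_space_alphaX)

text \<open>The remainder is a single point: the stabiliser of a finite set acts transitively off that
  set, so it moves points near one point of the remainder next to any other one, against the
  joint continuity of the action at the identity.\<close>
lemma G_compactification_unique:
  assumes inf: "infinite (UNIV :: 'a set)"
    and G: "G_compactification (perm_top :: ('a \<Rightarrow> 'a) topology) (\<lambda>g x. g x) (discrete_topology UNIV) K e \<alpha>"
  shows "equiv_compactification (discrete_topology UNIV) alphaX Some K e"
proof -
  have K: "compact_space K" "Hausdorff_space K" and emb: "embedding_map (discrete_topology UNIV) K e"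
    and dense: "K closure_of (range e) = topspace K"
    and cont: "continuous_map (prod_topology perm_top K) K (\<lambda>(g, y). \<alpha> g y)"
    and act: "\<And>g x. bij g \<Longrightarrow> \<alpha> g (e x) = e (g x)"
    using G unfolding G_compactification_def compactification_def by simp_all
  have hom: "homeomorphic_map (discrete_topology UNIV) (subtopology K (range e)) e"
    using emb by (simp add: embedding_map_def)
  have eK: "e x \<in> topspace K" for x
    using homeomorphic_imp_surjective_map[OF hom] by auto
  have inj: "inj e" using homeomorphic_imp_injective_map[OF hom] by simp
  have T1: "closedin K {z}" if "z \<in> topspace K" for z
    using that K(2) by (simp add: closedin_Hausdorff_singleton)
  have meets: "\<exists>x. e x \<in> U" if "openin K U" "z \<in> U" for U z
  proof -
    have "z \<in> K closure_of (range e)" using that openin_subset[of K U] unfolding dense by blast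
    then show ?thesis using that unfolding in_closure_of by blast
  qed
  \<comment> \<open>A relatively isolated point of a dense subset is isolated in the whole space:
    the rest of the witnessing open set would be open and miss the dense subset.\<close>
  have iso: "openin K {e x}" for x
  proof -
    have "openin (subtopology K (range e)) (e ` {x})"
      using homeomorphic_imp_open_map[OF hom] unfolding open_map_def by (metis openin_discrete_topology subset_UNIV)
    then obtain U where U: "openin K U" "{e x} = U \<inter> range e" unfolding openin_subtopology by auto
    have "U - {e x} = {}"
    proof (rule ccontr)
      assume "U - {e x} \<noteq> {}"
      then obtain z where "z \<in> U - {e x}" by blast
      moreover have "openin K (U - {e x})" using U(1) T1[OF eK] by (rule openin_diff)
      ultimately obtain y where "e y \<in> U - {e x}" using meets by blast
      then show False using U(2) by blast
    qed
    then have "U = {e x}" using U(2) by blast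
    then show ?thesis using U(1) by simp
  qed
  let ?R = "topspace K - range e"
  have range_open: "openin K (range e)"
  proof -
    have "openin K (\<Union>x. {e x})" by (rule openin_Union) (use iso in auto)
    then show ?thesis by (simp add: UNION_singleton_eq_range)
  qed
  \<comment> \<open>The complement of a neighbourhood of the remainder is compact and covered by
    isolated points.\<close>
  have cofinite: "finite {x. e x \<notin> U}" if U: "openin K U" "?R \<subseteq> U" for U
  proof -
    have "closedin K (topspace K - U)" using U(1) by blast
    then have "compactin K (topspace K - U)" using K(1) closedin_compact_space by blast
    moreover have "topspace K - U \<subseteq> \<Union>((\<lambda>x. {e x}) ` UNIV)" using U(2) by blast
    ultimately obtain \<F> where F: "finite \<F>" "\<F> \<subseteq> (\<lambda>x. {e x}) ` UNIV" "topspace K - U \<subseteq> \<Union>\<F>"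
      using compactinD[of K "topspace K - U" "(\<lambda>x. {e x}) ` UNIV"] iso by auto
    then have "finite (\<Union>\<F>)" by (intro finite_Union) auto
    then have "finite (topspace K - U)" using F(3) by (rule rev_finite_subset)
    then have "finite (e -` (topspace K - U))" using inj by (rule finite_vimageI)
    moreover have "{x. e x \<notin> U} \<subseteq> e -` (topspace K - U)" using eK by auto
    ultimately show ?thesis by (rule rev_finite_subset)
  qed
  have "?R \<noteq> {}"
  proof
    assume "?R = {}"
    then have "finite {x. e x \<notin> {}}" by (intro cofinite) simp_all
    then show False using inf by simp
  qed
  then obtain r where r: "r \<in> ?R" by blast
  have fresh: "\<exists>x. x \<notin> F \<and> e x \<in> U" if F: "finite F" and U: "openin K U" "z \<in> U" "z \<in> ?R" for F U z
  proof -
    have "closedin K (e ` F)"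
      using F eK by (intro closedin_Hausdorff_finite K(2)) auto
    then have "openin K (U - e ` F)" using U(1) by (intro openin_diff)
    moreover have "z \<in> U - e ` F" using U by blast
    ultimately obtain x where "e x \<in> U - e ` F" using meets by blast
    then show ?thesis by blast
  qed
  \<comment> \<open>The action law is given on the dense copy of \<open>X\<close>; continuity
    carries the identity law over to \<open>K\<close>.\<close>
  have id_act: "\<alpha> id z = z" if z: "z \<in> topspace K" for z
  proof (rule forall_in_closure_of_eq[where f = "\<alpha> id" and g = "\<lambda>z. z" and X = K and Y = K and S = "range e"])
    show "z \<in> K closure_of range e" using z dense by simp
    have "continuous_map K (prod_topology perm_top K) (\<lambda>z. (id, z))"
      by (simp add: continuous_map_pairwise comp_def)
    from continuous_map_compose[OF this cont] show "continuous_map K K (\<alpha> id)"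
      by (simp add: comp_def)
    fix x assume "x \<in> range e"
    then obtain y where "x = e y" by blast
    then show "\<alpha> id x = x" using act[of id y] by simp
  qed (use K(2) in simp_all)
  have single: "p = q" if pq: "p \<in> ?R" "q \<in> ?R" for p q
  proof (rule ccontr)
    assume "p \<noteq> q"
    then have "p \<in> topspace K \<and> q \<in> topspace K \<and> p \<noteq> q" using pq by simp
    then obtain A B where AB: "openin K A" "openin K B" "p \<in> A" "q \<in> B" "disjnt A B"
      using K(2)[unfolded Hausdorff_space_def, rule_format] by (elim exE conjE) blast
    let ?W = "{s \<in> topspace (prod_topology perm_top K). (case s of (g, y) \<Rightarrow> \<alpha> g y) \<in> A}"
    have "openin (prod_topology perm_top K) ?W"
      using cont AB(1) by (rule openin_continuous_map_preimage)
    note W = this[unfolded openin_prod_topology_alt, rule_format]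
    have "(id, p) \<in> ?W" using AB(3) pq(1) id_act by simp
    from W[OF this] obtain U P where UP: "openin perm_top U" "openin K P" "id \<in> U" "p \<in> P" "U \<times> P \<subseteq> ?W"
      by (elim exE conjE)
    obtain F where F: "finite F" "fixator F \<subseteq> U" using fixator_subset_if_openin[OF UP(1,3)] by blast
    obtain x where x: "x \<notin> F" "e x \<in> P" using fresh[OF F(1) UP(2,4) pq(1)] by blast
    obtain y where y: "y \<notin> F" "e y \<in> B" using fresh[OF F(1) AB(2,4) pq(2)] by blast
    \<comment> \<open>Both points avoid \<open>F\<close>, so the transposition is near the identity,
      yet it takes a point near \<open>p\<close> to one near \<open>q\<close>, that is, into
      \<open>A\<close> and \<open>B\<close> at once.\<close>
    let ?g = "Transposition.transpose x y"
    have "?g \<in> fixator F" using x(1) y(1) by (auto simp: fixator_def Transposition.transpose_def)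
    then have "(?g, e x) \<in> ?W" using UP(5) F(2) x(2) by blast
    then have "e y \<in> A" using act[of ?g x] by simp
    then show False using y(2) AB(5) by (auto simp: disjnt_def)
  qed
  define h where "h = case_option r e"
  have h: "h None = r" "\<And>x. h (Some x) = e x" by (simp_all add: h_def)
  have R: "?R = {r}" using r single by blast
  have surj: "h ` topspace alphaX = topspace K"
  proof -
    have "h ` UNIV = insert r (range e)" unfolding UNIV_option_conv by (simp add: h image_image)
    also have "\<dots> = topspace K" using R eK by auto
    finally show ?thesis by simp
  qed
  have "homeomorphic_map alphaX K h"
  proof (rule continuous_imp_homeomorphic_map)
    show "continuous_map alphaX K h"
      unfolding continuous_map_def
    proof (intro conjI allI impI)
      show "h \<in> topspace alphaX \<rightarrow> topspace K" using surj by blast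
      fix U assume U: "openin K U"
      have "finite (- {w. h w \<in> U})" if "r \<in> U"
      proof -
        have "- {w. h w \<in> U} \<subseteq> Some ` {x. e x \<notin> U}"
        proof
          fix w assume "w \<in> - {w. h w \<in> U}"
          then show "w \<in> Some ` {x. e x \<notin> U}" using that by (cases w) (auto simp: h)
        qed
        moreover have "finite {x. e x \<notin> U}" using that R by (intro cofinite[OF U]) simp
        ultimately show ?thesis by (meson finite_imageI finite_subset)
      qed
      then show "openin alphaX {w \<in> topspace alphaX. h w \<in> U}"
        by (simp add: openin_alphaX h)
    qed
    show "inj_on h (topspace alphaX)"
    proof (rule inj_onI)
      fix v w assume "h v = h w"
      moreover have "r \<notin> range e" using r by blast
      ultimately show "v = w" using inj by (cases v; cases w) (auto simp: h inj_eq)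
    qed
  qed (simp_all add: compact_space_alphaX K surj[simplified])
  then show ?thesis
    unfolding equiv_compactification_def by (intro exI[of _ h]) (simp add: h)
qed


section \<open>Maximality\<close>

text \<open>\<open>K\<close> need not be sequentially compact, so a convergent subsequence is
  replaced by a point lying in every closed set that contains a tail. In this form weak inequalities
  between continuous functions pass to it.\<close>

lemma compact_space_cluster_point:
  assumes "compact_space K" "\<And>n::nat. x n \<in> topspace K"
  obtains c where "c \<in> topspace K" "\<And>C n. closedin K C \<Longrightarrow> (\<And>i. n \<le> i \<Longrightarrow> x i \<in> C) \<Longrightarrow> c \<in> C"
proof -
  define A where "A n = K closure_of (x ` {n..})" for n
  have "(\<Inter>n. A n) \<noteq> {}"
  proof (rule compact_space_imp_nest[OF assms(1)])
    show "closedin K (A n)" for n by (simp add: A_def)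
    show "A n \<noteq> {}" for n
    proof -
      have "x ` {n..} \<subseteq> A n" unfolding A_def using assms(2) by (intro closure_of_subset) auto
      then show ?thesis by auto
    qed
    show "decseq A" unfolding decseq_def A_def by (auto intro!: closure_of_mono image_mono)
  qed
  then obtain c where c: "\<And>n. c \<in> A n" by blast
  show thesis
  proof (rule that[of c])
    show "c \<in> topspace K" using c[of 0] closure_of_subset_topspace[of K] unfolding A_def by blast
    fix C n assume "closedin K C" "\<And>i. n \<le> i \<Longrightarrow> x i \<in> C"
    then have "A n \<subseteq> C" unfolding A_def by (intro closure_of_minimal) auto
    then show "c \<in> C" using c by blast
  qed
qed

lemma closedin_real_preimage:
  fixes f :: "'k \<Rightarrow> real"
  assumes "continuous_map K euclideanreal f" "closed S"
  shows "closedin K {y \<in> topspace K. f y \<in> S}"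
  using closedin_continuous_map_preimage[OF assms(1), of S] assms(2) by simp

context
  fixes K :: "'k topology" and e :: "('a \<Rightarrow> 'a) \<Rightarrow> 'k" and m :: "'k \<Rightarrow> 'k \<Rightarrow> 'k"
  assumes sm: "sm_compactification (perm_top :: ('a \<Rightarrow> 'a) topology) (\<circ>) K e m"
begin

lemma sm_facts:
  shows sm_compact: "compact_space K" and sm_Hausdorff: "Hausdorff_space K"
    and sm_in: "\<And>g. bij g \<Longrightarrow> e g \<in> topspace K"
    and sm_left: "\<And>a. a \<in> topspace K \<Longrightarrow> continuous_map K K (m a)"
    and sm_right: "\<And>a. a \<in> topspace K \<Longrightarrow> continuous_map K K (\<lambda>x. m x a)"
    and sm_mult: "\<And>g h. bij g \<Longrightarrow> bij h \<Longrightarrow> m (e g) (e h) = e (g \<circ> h)"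
proof -
  have "embedding_map (perm_top :: ('a \<Rightarrow> 'a) topology) K e"
    using sm unfolding sm_compactification_def compactification_def by simp
  from homeomorphic_imp_surjective_map[OF this[unfolded embedding_map_def]]
  show "\<And>g. bij g \<Longrightarrow> e g \<in> topspace K" by auto
qed (use sm in \<open>simp_all add: sm_compactification_def compactification_def\<close>)

context
  fixes u :: "'k \<Rightarrow> real"
  assumes u: "continuous_map K euclideanreal u"
begin

text \<open>The function \<open>?f\<close> vanishes at \<open>id\<close> for every second argument
  in \<open>K\<close>, and the tube lemma makes it small near \<open>id\<close> uniformly in that
  argument, which is then taken in the group.\<close>

lemma left_uniformly_continuous:
  assumes "0 < \<epsilon>"
  obtains F where "finite F"
    "\<And>b g. b \<in> fixator F \<Longrightarrow> bij g \<Longrightarrow> \<bar>u (e (b \<circ> g)) - u (e g)\<bar> < \<epsilon>"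
proof -
  have cont: "continuous_map (prod_topology perm_top K) K (\<lambda>(g, y). m (e g) y)"
    and dense: "K closure_of (e ` {g. bij g}) = topspace K"
    using sm unfolding sm_compactification_def compactification_def by simp_all
  \<comment> \<open>The definition grants some unit; that \<open>e id\<close> acts as a left unit
    follows from density of the group.\<close>
  have unit: "m (e id) y = y" if y: "y \<in> topspace K" for y
  proof (rule forall_in_closure_of_eq[where f = "m (e id)" and g = "\<lambda>z. z" and X = K and Y = K and S = "e ` {g. bij g}"])
    show "y \<in> K closure_of (e ` {g. bij g})" using y dense by simp
    fix x assume "x \<in> e ` {g. bij g}"
    then obtain g where "bij g" "x = e g" by blast
    then show "m (e id) x = x" using sm_mult[of id g] by simp
  qed (use sm_Hausdorff sm_left[OF sm_in] in simp_all)
  let ?f = "\<lambda>p. u (m (e (fst p)) (snd p)) - u (snd p)"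
  have "continuous_map (prod_topology perm_top K) K (\<lambda>p. m (e (fst p)) (snd p))"
    using cont by (simp add: case_prod_unfold)
  from continuous_map_compose[OF this u] continuous_map_compose[OF continuous_map_snd u]
  have "continuous_map (prod_topology perm_top K) euclideanreal ?f"
    by (intro continuous_map_diff) (simp_all add: comp_def)
  then have "openin (prod_topology perm_top K) {p \<in> topspace (prod_topology perm_top K). ?f p \<in> {- \<epsilon><..<\<epsilon>}}"
    (is "openin _ ?W") by (rule openin_continuous_map_preimage) simp
  moreover have "{id} \<times> topspace K \<subseteq> ?W" using assms unit by auto
  moreover have "compactin K (topspace K)" using sm_compact by (simp add: compact_space_def)
  ultimately obtain U V where UV: "openin perm_top U" "id \<in> U" "topspace K \<subseteq> V" "U \<times> V \<subseteq> ?W"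
    using tube_lemma_right[of perm_top K ?W "topspace K" id] by auto
  obtain F where F: "finite F" "fixator F \<subseteq> U" using fixator_subset_if_openin[OF UV(1,2)] by blast
  show thesis
  proof (rule that[OF F(1)])
    fix b g :: "'a \<Rightarrow> 'a" assume bg: "b \<in> fixator F" "bij g"
    then have "e g \<in> V" using UV(3) sm_in by blast
    then have "(b, e g) \<in> ?W" using UV(4) F(2) bg(1) by blast
    then have "\<bar>u (m (e b) (e g)) - u (e g)\<bar> < \<epsilon>" by auto
    then show "\<bar>u (e (b \<circ> g)) - u (e g)\<bar> < \<epsilon>" using sm_mult[OF fixatorD(1)[OF bg(1)] bg(2)] by simp
  qed
qed

text \<open>A double limit argument: if uniform continuity failed, there would be permutations
  \<open>g i\<close>, \<open>g' i\<close> and \<open>h j\<close> with \<open>u (g i * h j)\<close> close to \<open>u (g i)\<close> for \<open>i\<close> large compared with \<open>j\<close>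
  and close to the distant value \<open>u (g' i)\<close> for \<open>j > i\<close>, which separate continuity at a pair of
  cluster points of \<open>g\<close> and \<open>h\<close> excludes.\<close>
lemma right_uniformly_continuous:
  assumes "0 < \<epsilon>"
  obtains E where "finite E"
    "\<And>a g. a \<in> fixator E \<Longrightarrow> bij g \<Longrightarrow> \<bar>u (e (g \<circ> a)) - u (e g)\<bar> < \<epsilon>"
proof (rule ccontr)
  note witness = that
  assume no: "\<not> thesis"
  have bad: "\<exists>a g. a \<in> fixator E \<and> bij g \<and> \<epsilon> \<le> \<bar>u (e (g \<circ> a)) - u (e g)\<bar>" if E: "finite E" for E
  proof (rule ccontr)
    assume "\<not> ?thesis"
    then have "\<bar>u (e (g \<circ> a)) - u (e g)\<bar> < \<epsilon>" if "a \<in> fixator E" "bij g" for a g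
      using that by force
    then show False using no witness[OF E] by blast
  qed
  \<comment> \<open>Two errors of at most \<open>\<delta>\<close> will be compared with a gap
    \<open>\<epsilon>\<close>, so any positive constant below \<open>\<epsilon> / 2\<close> would
    do.\<close>
  define \<delta> where "\<delta> = \<epsilon> / 4"
  have "0 < \<delta>" using assms by (simp add: \<delta>_def)
  then obtain F where F: "finite F"
    "\<And>b g. b \<in> fixator F \<Longrightarrow> bij g \<Longrightarrow> \<bar>u (e (b \<circ> g)) - u (e g)\<bar> < \<delta>"
    using left_uniformly_continuous by blast
  \<comment> \<open>If the inverses agree on \<open>F\<close>, then \<open>?b\<close> fixes
    \<open>F\<close> and carries \<open>k\<close> to \<open>k'\<close>. So \<open>u\<close> at a
    permutation depends, up to \<open>\<delta>\<close>, only on the inverse on \<open>F\<close>,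
    which is why inverses are used from here on.\<close>
  have close: "\<bar>u (e k') - u (e k)\<bar> \<le> \<delta>"
    if k: "bij k" "bij k'" and eq: "\<And>y. y \<in> F \<Longrightarrow> inv k y = inv k' y" for k k'
  proof -
    let ?b = "k' \<circ> inv k"
    have "?b \<in> fixator F"
      unfolding fixator_def using k eq
      by (simp add: bij_comp bij_imp_bij_inv bij_is_surj surj_f_inv_f)
    from F(2)[OF this k(1)] show ?thesis
      using k(1) by (simp add: comp_assoc bij_is_inj)
  qed
  define B where "B = {(p, p'). bij p \<and> bij p' \<and> \<epsilon> \<le> \<bar>u (e (inv p')) - u (e (inv p))\<bar>}"
  \<comment> \<open>Since \<open>a (?p' y) = ?p y\<close> and \<open>a\<close> fixes
    \<open>E\<close>, the two values coincide as soon as one of them lies in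
    \<open>E\<close>.\<close>
  have B: "\<exists>(p, p') \<in> B. \<forall>y\<in>F. p y \<in> E \<or> p' y \<in> E \<longrightarrow> p y = p' y" if E: "finite E" for E
  proof -
    obtain a g where ag: "a \<in> fixator E" "bij g" "\<epsilon> \<le> \<bar>u (e (g \<circ> a)) - u (e g)\<bar>"
      using bad[OF E] by blast
    have a: "bij a" "\<And>x. x \<in> E \<Longrightarrow> a x = x" using ag(1) by (auto simp: fixator_def)
    let ?p = "inv g" and ?p' = "inv (g \<circ> a)"
    have bij: "bij ?p" "bij ?p'" "inv ?p = g" "inv ?p' = g \<circ> a"
      using ag(2) a(1) by (simp_all add: bij_imp_bij_inv bij_comp inv_inv_eq)
    have ap: "a (?p' y) = ?p y" for y
      using ag(2) a(1) by (simp add: o_inv_distrib bij_is_surj surj_f_inv_f)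
    have "?p y = ?p' y" if y: "?p y \<in> E \<or> ?p' y \<in> E" for y
    proof (cases "?p' y \<in> E")
      case True
      then show ?thesis using ap[of y] a(2) by simp
    next
      case False
      then have "a (?p y) = ?p y" using y a(2) by blast
      then have "a (?p y) = a (?p' y)" using ap by simp
      then show ?thesis using a(1) by (simp add: bij_is_inj inj_eq)
    qed
    moreover have "(?p, ?p') \<in> B" using bij ag(3) by (simp add: B_def)
    ultimately show ?thesis by blast
  qed
  have injB: "inj_on p F \<and> inj_on p' F" if "(p, p') \<in> B" for p p'
    using that by (auto simp: B_def bij_def intro: inj_on_subset)
  obtain p p' h where pp: "\<And>i::nat. (p i, p' i) \<in> B" and h: "\<And>j::nat. bij (h j)"
    and far: "\<And>i j y. i < j \<Longrightarrow> y \<in> F \<Longrightarrow> h j (p' i y) = p i y"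
    and near: "\<And>j. 0 < j \<Longrightarrow> \<exists>n. \<forall>i\<ge>n. \<forall>y\<in>F. h j (p i y) = p i y"
    using escaping_sequence[OF F(1) injB B] by metis
  define g g' where "g i = inv (p i)" and "g' i = inv (p' i)" for i
  have p: "bij (p i)" "bij (p' i)" "\<epsilon> \<le> \<bar>u (e (g' i)) - u (e (g i))\<bar>" for i
    using pp[of i] by (simp_all add: B_def g_def g'_def)
  have g: "bij (g i)" "bij (g' i)" "inv (g i) = p i" "inv (g' i) = p' i" for i
    using p by (simp_all add: g_def g'_def bij_imp_bij_inv inv_inv_eq)
  have inv_gh: "inv (g i \<circ> h j) y = inv (h j) (p i y)" for i j y
    using g(1,3) h by (simp add: o_inv_distrib)
  have inv_h: "inv (h j) v = w" if "h j w = v" for j v w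
    using that h[of j] by (simp add: inv_f_eq bij_is_inj)
  have far': "\<bar>u (e (g i \<circ> h j)) - u (e (g' i))\<bar> \<le> \<delta>" if "i < j" for i j
  proof (rule close)
    show "inv (g' i) y = inv (g i \<circ> h j) y" if "y \<in> F" for y
      unfolding inv_gh g using inv_h[OF far[OF \<open>i < j\<close> that]] by simp
  qed (use g h in \<open>auto intro: bij_comp\<close>)
  \<comment> \<open>The shift to \<open>Suc j\<close> leaves out \<open>h 0\<close>, about which
    \<open>near\<close> says nothing.\<close>
  have near': "\<exists>n. \<forall>i\<ge>n. \<bar>u (e (g i \<circ> h (Suc j))) - u (e (g i))\<bar> \<le> \<delta>" for j
  proof -
    obtain n where n: "\<And>i y. n \<le> i \<Longrightarrow> y \<in> F \<Longrightarrow> h (Suc j) (p i y) = p i y" using near[of "Suc j"] by auto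
    have "\<bar>u (e (g i \<circ> h (Suc j))) - u (e (g i))\<bar> \<le> \<delta>" if "n \<le> i" for i
    proof (rule close)
      show "inv (g i) y = inv (g i \<circ> h (Suc j)) y" if "y \<in> F" for y
        unfolding inv_gh g using inv_h[OF n[OF \<open>n \<le> i\<close> that]] by simp
    qed (use g h in \<open>auto intro: bij_comp\<close>)
    then show ?thesis by blast
  qed
  obtain \<gamma> where \<gamma>: "\<gamma> \<in> topspace K" "\<And>C n. closedin K C \<Longrightarrow> (\<And>i. n \<le> i \<Longrightarrow> e (g i) \<in> C) \<Longrightarrow> \<gamma> \<in> C"
    using compact_space_cluster_point[OF sm_compact, of "\<lambda>i. e (g i)"] g(1) sm_in by blast
  obtain \<eta> where \<eta>: "\<eta> \<in> topspace K" "\<And>C n. closedin K C \<Longrightarrow> (\<And>j. n \<le> j \<Longrightarrow> e (h (Suc j)) \<in> C) \<Longrightarrow> \<eta> \<in> C"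
    using compact_space_cluster_point[OF sm_compact, of "\<lambda>j. e (h (Suc j))"] h sm_in by blast
  have contr: "continuous_map K euclideanreal (\<lambda>y. \<bar>u (m y c) - u y\<bar>)" if "c \<in> topspace K" for c
    using continuous_map_compose[OF sm_right[OF that] u] u
    by (intro continuous_map_real_abs continuous_map_diff) (simp_all add: comp_def)
  have contl: "continuous_map K euclideanreal (\<lambda>y. \<bar>u (m c y) - r\<bar>)" if "c \<in> topspace K" for c r
    using continuous_map_compose[OF sm_left[OF that] u]
    by (intro continuous_map_real_abs continuous_map_diff) (simp_all add: comp_def)
  \<comment> \<open>One order of the limits: for fixed \<open>j\<close> pass to
    \<open>\<gamma>\<close> by continuity of right multiplication, afterwards to
    \<open>\<eta>\<close> by continuity of left multiplication.\<close>
  have "\<bar>u (m \<gamma> (e (h (Suc j)))) - u \<gamma>\<bar> \<le> \<delta>" for j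
  proof -
    obtain n where n: "\<And>i. n \<le> i \<Longrightarrow> \<bar>u (e (g i \<circ> h (Suc j))) - u (e (g i))\<bar> \<le> \<delta>" using near'[of j] by blast
    have "\<gamma> \<in> {y \<in> topspace K. \<bar>u (m y (e (h (Suc j)))) - u y\<bar> \<in> {..\<delta>}}"
      by (rule \<gamma>(2)[OF closedin_real_preimage[OF contr], where n = n])
         (use h sm_in g(1) n sm_mult in \<open>simp_all\<close>)
    then show ?thesis by simp
  qed
  then have "\<eta> \<in> {y \<in> topspace K. \<bar>u (m \<gamma> y) - u \<gamma>\<bar> \<in> {..\<delta>}}"
    using h sm_in by (intro \<eta>(2)[OF closedin_real_preimage[OF contl[OF \<gamma>(1)]], where n = 0]) simp_all
  then have small: "\<bar>u (m \<gamma> \<eta>) - u \<gamma>\<bar> \<le> \<delta>" by simp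
  \<comment> \<open>The other order: for fixed \<open>i\<close> pass to \<open>\<eta>\<close> first,
    where the products stay close to the distant value at \<open>g' i\<close>; the tail starts at
    \<open>i\<close> because \<open>far'\<close> needs \<open>i < Suc j\<close>.\<close>
  have large: "\<epsilon> - \<delta> \<le> \<bar>u (m (e (g i)) \<eta>) - u (e (g i))\<bar>" for i
  proof -
    have "\<eta> \<in> {y \<in> topspace K. \<bar>u (m (e (g i)) y) - u (e (g' i))\<bar> \<in> {..\<delta>}}"
      by (rule \<eta>(2)[OF closedin_real_preimage[OF contl], where n = i])
         (use h sm_in g(1) far' sm_mult in \<open>simp_all\<close>)
    then have "\<bar>u (m (e (g i)) \<eta>) - u (e (g' i))\<bar> \<le> \<delta>" by simp
    then show ?thesis using p(3)[of i] by linarith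
  qed
  have "\<gamma> \<in> {y \<in> topspace K. \<bar>u (m y \<eta>) - u y\<bar> \<in> {\<epsilon> - \<delta>..}}"
    by (rule \<gamma>(2)[OF closedin_real_preimage[OF contr[OF \<eta>(1)]], where n = 0]) (use large sm_in g(1) in simp_all)
  then show False using small assms by (simp add: \<delta>_def)
qed

text \<open>Go from \<open>g\<close> to \<open>a o g o b\<close> through \<open>g o b\<close>: the
  factor \<open>b\<close> is paid for by the right estimate at \<open>g\<close>, the factor
  \<open>a\<close> by the left estimate at \<open>g o b\<close>.\<close>

lemma roelcke_uniformly_continuous:
  assumes "0 < \<epsilon>"
  obtains F where "finite F"
    "\<And>g g'. bij g \<Longrightarrow> bij g' \<Longrightarrow> agree F (map_option g) (map_option g') \<Longrightarrow> \<bar>u (e g) - u (e g')\<bar> \<le> \<epsilon>"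
proof -
  obtain F1 where F1: "finite F1" "\<And>b g. b \<in> fixator F1 \<Longrightarrow> bij g \<Longrightarrow> \<bar>u (e (b \<circ> g)) - u (e g)\<bar> < \<epsilon> / 2"
    using left_uniformly_continuous[of "\<epsilon> / 2"] assms by auto
  obtain F2 where F2: "finite F2" "\<And>a g. a \<in> fixator F2 \<Longrightarrow> bij g \<Longrightarrow> \<bar>u (e (g \<circ> a)) - u (e g)\<bar> < \<epsilon> / 2"
    using right_uniformly_continuous[of "\<epsilon> / 2"] assms by auto
  show thesis
  proof (rule that[of "F1 \<union> F2"])
    fix g g' :: "'a \<Rightarrow> 'a"
    assume g: "bij g" "bij g'" "agree (F1 \<union> F2) (map_option g) (map_option g')"
    have "finite (F1 \<union> F2)" using F1(1) F2(1) by simp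
    from double_coset_if_agree[OF this g] obtain a b
      where ab: "a \<in> fixator (F1 \<union> F2)" "b \<in> fixator (F1 \<union> F2)" "g' = a \<circ> g \<circ> b" by blast
    then have "a \<in> fixator F1" "b \<in> fixator F2" "bij b" by (auto simp: fixator_def)
    then have "\<bar>u (e (a \<circ> (g \<circ> b))) - u (e (g \<circ> b))\<bar> < \<epsilon> / 2" "\<bar>u (e (g \<circ> b)) - u (e g)\<bar> < \<epsilon> / 2"
      using F1(2)[of a "g \<circ> b"] F2(2)[of b g] g(1) by (simp_all add: bij_comp)
    then show "\<bar>u (e g) - u (e g')\<bar> \<le> \<epsilon>" unfolding ab(3) comp_assoc by linarith
  qed (use F1 F2 in simp)
qed

end

end

text \<open>As value at \<open>z\<close> take any point in the closures of the images of all sets of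
  permutations agreeing with \<open>z\<close> on a finite set; compactness provides one. Real
  functions separate points from closed sets in \<open>K\<close>, so their uniform estimates yield
  both continuity and the prescribed values.\<close>

lemma pinj_top_extension:
  assumes inf: "infinite (UNIV :: 'a set)" and K: "compact_space K" "Hausdorff_space K"
    and eK: "\<And>g :: 'a \<Rightarrow> 'a. bij g \<Longrightarrow> e g \<in> topspace K"
    and unif: "\<And>u \<epsilon>. continuous_map K euclideanreal u \<Longrightarrow> 0 < \<epsilon> \<Longrightarrow> \<exists>F. finite F \<and>
      (\<forall>g g'. bij g \<longrightarrow> bij g' \<longrightarrow> agree F (map_option g) (map_option g') \<longrightarrow> \<bar>u (e g) - u (e g')\<bar> \<le> \<epsilon>)"
  obtains h where "continuous_map pinj_top K h" "\<And>g. bij g \<Longrightarrow> h (map_option g) = e g"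
proof -
  define N where "N F z = {g. bij g \<and> agree F z (map_option g)}" for F and z :: "'a option \<Rightarrow> 'a option"
  have N_ne: "N F z \<noteq> {}" if "finite F" "z \<in> pinj_maps" for F z
    using permutation_agreeing[OF inf that] unfolding N_def by blast
  have N_sub: "e ` N F z \<subseteq> topspace K" for F z using eK by (auto simp: N_def)
  have "\<exists>k. k \<in> topspace K \<and> (\<forall>F. finite F \<longrightarrow> k \<in> K closure_of (e ` N F z))" if z: "z \<in> pinj_maps" for z
  proof -
    let ?C = "\<lambda>F. K closure_of (e ` N F z)"
    have "topspace K \<inter> \<Inter>(?C ` {F. finite F}) \<noteq> {}"
    proof -
      have "topspace K \<inter> \<Inter>\<F> \<noteq> {}" if fF: "finite \<F>" "\<F> \<subseteq> ?C ` {F. finite F}" for \<F>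
      proof -
        obtain Z where Z: "finite Z" "Z \<subseteq> {F. finite F}" "\<F> = ?C ` Z"
          using finite_subset_image[OF fF] by blast
        \<comment> \<open>A permutation agreeing with \<open>z\<close> on the union lies in all of
          the finitely many sets at once.\<close>
        have "finite (\<Union>Z)" using Z by auto
        then obtain g where g: "g \<in> N (\<Union>Z) z" using N_ne[OF _ z] by blast
        have "e g \<in> ?C F" if "F \<in> Z" for F
        proof -
          have "g \<in> N F z" using g that unfolding N_def by (auto intro: agree_mono)
          then show ?thesis using closure_of_subset[OF N_sub] by blast
        qed
        moreover have "e g \<in> topspace K" using g N_sub by blast
        ultimately show ?thesis using Z(3) by blast
      qed
      moreover have "compactin K (topspace K)" using K(1) by (simp add: compact_space_def)
      ultimately show ?thesis
        unfolding compactin_fip by (elim conjE allE[of _ "?C ` {F. finite F}"]) auto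
    qed
    then show ?thesis by blast
  qed
  then have "\<forall>z\<in>pinj_maps. \<exists>k. k \<in> topspace K \<and> (\<forall>F. finite F \<longrightarrow> k \<in> K closure_of (e ` N F z))"
    by (rule ballI)
  from bchoice[OF this] obtain h where h': "\<forall>z\<in>pinj_maps. h z \<in> topspace K \<and> (\<forall>F. finite F \<longrightarrow> h z \<in> K closure_of (e ` N F z))"
    by (elim exE)
  then have hK: "\<And>z. z \<in> pinj_maps \<Longrightarrow> h z \<in> topspace K"
    and h: "\<And>z F. z \<in> pinj_maps \<Longrightarrow> finite F \<Longrightarrow> h z \<in> K closure_of (e ` N F z)" by auto
  have est: "\<exists>F. finite F \<and> (\<forall>z g. z \<in> pinj_maps \<longrightarrow> bij g \<longrightarrow> agree F z (map_option g) \<longrightarrow> \<bar>u (h z) - u (e g)\<bar> \<le> \<epsilon>)"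
    if u: "continuous_map K euclideanreal u" and pos: "0 < \<epsilon>" for u \<epsilon>
  proof -
    obtain F where F: "finite F"
      "\<And>g g'. bij g \<Longrightarrow> bij g' \<Longrightarrow> agree F (map_option g) (map_option g') \<Longrightarrow> \<bar>u (e g) - u (e g')\<bar> \<le> \<epsilon>"
      using unif[OF u pos] by blast
    have "\<bar>u (h z) - u (e g)\<bar> \<le> \<epsilon>" if z: "z \<in> pinj_maps" and g: "bij g" "agree F z (map_option g)" for z g
    proof (rule forall_in_closure_of[OF h[OF z F(1)]])
      fix x assume "x \<in> e ` N F z"
      then obtain g' where g': "x = e g'" "bij g'" "agree F z (map_option g')" by (auto simp: N_def)
      then show "\<bar>u x - u (e g)\<bar> \<le> \<epsilon>"
        using F(2)[of g' g] g agree_trans[OF agree_sym[OF g'(3)] g(2)] by simp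
    next
      have "continuous_map K euclideanreal (\<lambda>x. \<bar>u x - u (e g)\<bar>)"
        using u by (intro continuous_map_real_abs continuous_map_diff) simp_all
      from closedin_real_preimage[OF this, of "{..\<epsilon>}"]
      show "closedin K {x \<in> topspace K. \<bar>u x - u (e g)\<bar> \<le> \<epsilon>}" by simp
    qed
    then show ?thesis using F(1) by blast
  qed
  have "completely_regular_space K"
    using K by (intro normal_imp_completely_regular_space compact_Hausdorff_or_regular_imp_normal_space) simp_all
  then have sep: "\<exists>u. continuous_map K euclideanreal u \<and> u x = 0 \<and> u ` C \<subseteq> {1}"
    if "closedin K C" "x \<in> topspace K - C" for C x
    using that unfolding completely_regular_space_alt by blast
  show thesis
  proof (rule that[of h])
    show "continuous_map pinj_top K h"
      unfolding continuous_map_def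
    proof (intro conjI allI impI)
      show "h \<in> topspace pinj_top \<rightarrow> topspace K" unfolding topspace_pinj_top using hK by blast
      fix U assume U: "openin K U"
      have "\<exists>F. finite F \<and> {f \<in> pinj_maps. agree F z f} \<subseteq> {z \<in> pinj_maps. h z \<in> U}"
        if z: "z \<in> pinj_maps" "h z \<in> U" for z
      proof -
        have "closedin K (topspace K - U)" "h z \<in> topspace K - (topspace K - U)" using U z hK by auto
        then obtain u where u: "continuous_map K euclideanreal u" "u (h z) = 0" "u ` (topspace K - U) \<subseteq> {1}"
          using sep by blast
        obtain F where F: "finite F"
          "\<And>z g. z \<in> pinj_maps \<Longrightarrow> bij g \<Longrightarrow> agree F z (map_option g) \<Longrightarrow> \<bar>u (h z) - u (e g)\<bar> \<le> 1/4"
          using est[OF u(1), of "1/4"] by auto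
        \<comment> \<open>The same permutation agrees on \<open>F\<close> with every
          \<open>f\<close> that agrees with \<open>z\<close>; its value would be within 1/4 of both
          \<open>u (h z) = 0\<close> and \<open>u (h f) = 1\<close>.\<close>
        obtain g where g: "bij g" "agree F z (map_option g)" using permutation_agreeing[OF inf F(1) z(1)] by blast
        have "h f \<in> U" if f: "f \<in> pinj_maps" "agree F z f" for f
        proof (rule ccontr)
          assume "h f \<notin> U"
          then have "u (h f) = 1" using u(3) hK[OF f(1)] by blast
          moreover have "\<bar>u (h f) - u (e g)\<bar> \<le> 1/4"
            using F(2)[OF f(1) g(1)] agree_trans[OF agree_sym[OF f(2)] g(2)] by blast
          moreover have "\<bar>u (h z) - u (e g)\<bar> \<le> 1/4" by (rule F(2)[OF z(1) g])
          ultimately show False using u(2) by linarith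
        qed
        then show ?thesis using F(1) by blast
      qed
      then show "openin pinj_top {z \<in> topspace pinj_top. h z \<in> U}"
        unfolding openin_pinj_top topspace_pinj_top by blast
    qed
    fix g :: "'a \<Rightarrow> 'a" assume g: "bij g"
    show "h (map_option g) = e g"
    proof (rule ccontr)
      assume "h (map_option g) \<noteq> e g"
      moreover have hg: "h (map_option g) \<in> topspace K" using g by (intro hK map_option_pinj)
      then have "closedin K {h (map_option g)}" using K(2) by (simp add: closedin_Hausdorff_singleton)
      ultimately obtain u where u: "continuous_map K euclideanreal u" "u (e g) = 0" "u (h (map_option g)) = 1"
        using sep[of "{h (map_option g)}" "e g"] eK[OF g] by auto
      obtain F where "\<And>z g. z \<in> pinj_maps \<Longrightarrow> bij g \<Longrightarrow> agree F z (map_option g) \<Longrightarrow> \<bar>u (h z) - u (e g)\<bar> \<le> 1/4"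
        using est[OF u(1), of "1/4"] by auto
      from this[OF map_option_pinj[OF g] g agree_refl] show False using u by simp
    qed
  qed
qed

lemma sm_compactification_quotient_of_pinj_top:
  assumes inf: "infinite (UNIV :: 'a set)"
    and sm: "sm_compactification (perm_top :: ('a \<Rightarrow> 'a) topology) (\<circ>) K e m"
  obtains h where "continuous_map pinj_top K h" "\<And>g. bij g \<Longrightarrow> h (map_option g) = e g"
proof (rule pinj_top_extension[OF inf])
  show "compact_space K" "Hausdorff_space K"
    using sm by (simp_all add: sm_compactification_def compactification_def)
  show "e g \<in> topspace K" if "bij g" for g
    using sm_in[OF sm that] .
  show "\<exists>F. finite F \<and> (\<forall>g g'. bij g \<longrightarrow> bij g' \<longrightarrow> agree F (map_option g) (map_option g') \<longrightarrow> \<bar>u (e g) - u (e g')\<bar> \<le> \<epsilon>)"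
    if u: "continuous_map K euclideanreal u" and "0 < \<epsilon>" for u and \<epsilon> :: real
  proof -
    obtain F where "finite F"
      "\<And>g g'. bij g \<Longrightarrow> bij g' \<Longrightarrow> agree F (map_option g) (map_option g') \<Longrightarrow> \<bar>u (e g) - u (e g')\<bar> \<le> \<epsilon>"
      using roelcke_uniformly_continuous[OF sm u \<open>0 < \<epsilon>\<close>] by blast
    then show ?thesis by blast
  qed
qed (rule that)


theorem mainTheorem8:
  assumes X_inf: "infinite (UNIV :: 'a set)"
  shows
   \<comment> \<open>(a)\<close>
   "(G_compactification (perm_top :: ('a \<Rightarrow> 'a) topology) (\<lambda>g x. g x) (discrete_topology UNIV)
        alphaX Some (\<lambda>g. map_option g)
     \<and> (\<forall>(K :: 'k topology) e \<alpha>.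
          G_compactification (perm_top :: ('a \<Rightarrow> 'a) topology) (\<lambda>g x. g x) (discrete_topology UNIV) K e \<alpha>
          \<longrightarrow> equiv_compactification (discrete_topology UNIV) alphaX Some K e))
   \<comment> \<open>(b)\<close>
   \<and> roelcke_compactification (perm_top :: ('a \<Rightarrow> 'a) topology) (\<circ>) id
        (env_top alphaX (\<lambda>g. map_option g) (topspace perm_top))
        (env_map alphaX (\<lambda>g. map_option g))
   \<and> roelcke_precompact (perm_top :: ('a \<Rightarrow> 'a) topology) (\<circ>) id
   \<comment> \<open>(c)\<close>
   \<and> roelcke_compactification (perm_top :: ('a \<Rightarrow> 'a) topology) (\<circ>) id
        (subtopology (product_topology (\<lambda>_. alphaX) UNIV) pinj_maps) (\<lambda>g. map_option g)
   \<comment> \<open>(d)\<close>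
   \<and> sim_compactification (perm_top :: ('a \<Rightarrow> 'a) topology) (\<circ>)
        (env_top alphaX (\<lambda>g. map_option g) (topspace perm_top))
        (env_map alphaX (\<lambda>g. map_option g)) (\<circ>)
   \<and> (\<exists>\<phi>. monoid_iso_to_IX (topspace (env_top (alphaX :: 'a option topology) (\<lambda>g. map_option g) (topspace perm_top)))
            (\<circ>) (UNIV :: 'a set) \<phi>)
   \<and> (\<forall>(K :: 'l topology) e m.
        sm_compactification (perm_top :: ('a \<Rightarrow> 'a) topology) (\<circ>) K e m \<longrightarrow>
        (\<exists>h. continuous_map (env_top alphaX (\<lambda>g. map_option g) (topspace perm_top)) K h
             \<and> (\<forall>g\<in>topspace perm_top. h (env_map alphaX (\<lambda>g. map_option g) g) = e g)))"
proof -
  have max: "\<exists>h. continuous_map pinj_top K h \<and> (\<forall>g\<in>topspace perm_top. h (map_option g) = e g)"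
    if sm: "sm_compactification (perm_top :: ('a \<Rightarrow> 'a) topology) (\<circ>) K e m" for K :: "'l topology" and e m
  proof -
    obtain h where "continuous_map pinj_top K h" "\<And>g. bij g \<Longrightarrow> h (map_option g) = e g"
      using sm_compactification_quotient_of_pinj_top[OF X_inf sm] by blast
    then show ?thesis by (intro exI[of _ h]) simp
  qed
  \<comment> \<open>After rewriting, the Roelcke compactification statements of (b) and (c)
    coincide.\<close>
  show ?thesis
    unfolding env_top_eq[OF X_inf] env_map_eq topspace_pinj_top
    by (intro conjI allI impI exI[of _ "\<lambda>f. f \<circ> Some"] G_compactification_alphaX[OF X_inf]
        G_compactification_unique[OF X_inf] roelcke_compactification_pinj_top[OF X_inf]
        roelcke_precompact_perm_top sim_compactification_pinj_top[OF X_inf] monoid_iso_pinj_maps max)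
qed


end
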